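(* Let $1\leq p_1,\dots,p_m<\infty$, and $\frac1p=\frac1{p_1}+\dots+\frac1{p_m}$. Let $w_1,\dots,w_m$, and $\nu$ be weights on $\mathbb R^n$. There exists a constant $C>0$ such that the inequality $$\Vert\mathcal M(\vec f)\Vert_{L^{p,\infty}(\nu)}\leq C\prod_{i=1}^m\Vert f_i\Vert_{L^{p_i,1}(w_i)}$$ holds for every vector of measurable functions $\vec f=(f_1,\dots,f_m)$ if, and only if, $$[\vec w,\nu]_{A_{\vec P}^{\mathcal R}}:=\sup_Q\nu(Q)^{1/p}\prod_{i=1}^m\frac{\Vert\chi_Qw_i^{-1}\Vert_{L^{p_i',\infty}(w_i)}}{|Q|}<\infty,$$ where the supremum is over all cubes $Q\subseteq\mathbb R^n$.
   Context: A weight is a positive, locally integrable function on $\mathbb R^n$. Cubes have sides parallel to the axes. For a weight $w$ and a measurable set $E$, $w(E)=\int_E w(x)\,dx$, and $\frac1{p_i}+\frac1{p_i'}=1$. The multi(sub)linear maximal operator is $\mathcal M(\vec f)=\sup_Q\left(\prod_{i=1}^m\frac1{|Q|}\int_Q|f_i|\right)\chi_Q$, the supremum being over all cubes $Q$. For a weight $w$ (identified with the measure $w(x)\,dx$), put $\lambda_f^w(y)=w(\{x:|f(x)|>y\})$. For $q>0$: $\Vert f\Vert_{L^{q,1}(w)}=q\int_0^\infty \lambda_f^w(y)^{1/q}\,dy$ and $\Vert f\Vert_{L^{q,\infty}(w)}=\sup_{y>0} y\,\lambda_f^w(y)^{1/q}$; $L^{\infty,\infty}(w)$ means $L^\infty(w)$.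 *)

theory Defs
  imports "HOL-Analysis.Analysis" "HOL-Probability.Essential_Supremum"
begin

definition weight :: "(real^'n \<Rightarrow> real) \<Rightarrow> bool" where
  "weight w \<longleftrightarrow> w \<in> borel_measurable lebesgue \<and> (\<forall>x. 0 < w x) \<and>
     (\<forall>K. compact K \<longrightarrow> set_integrable lebesgue K w)"

definition weight_measure :: "(real^'n \<Rightarrow> real) \<Rightarrow> (real^'n) measure" where
  "weight_measure w = density lebesgue (\<lambda>x. ennreal (w x))"

(* Cubes are closed and nondegenerate; the suprema below do not change if open cubes are used. *)
definition cubes :: "(real^'n) set set" where
  "cubes = {cbox a (\<chi> i. a $ i + l) | a l. 0 < l}"

definition multi_maximal :: "nat \<Rightarrow> (nat \<Rightarrow> real^'n \<Rightarrow> real) \<Rightarrow> real^'n \<Rightarrow> ennreal" where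
  "multi_maximal m f x =
     (SUP Q\<in>cubes. (\<Prod>i\<in>{1..m}. (\<integral>\<^sup>+y\<in>Q. ennreal \<bar>f i y\<bar> \<partial>lebesgue) / emeasure lebesgue Q)
        * indicator Q x)"

(* Meant for r > 0 only. *)
definition ennreal_powr :: "ennreal \<Rightarrow> real \<Rightarrow> ennreal" where
  "ennreal_powr a r = (if a = \<infinity> then \<infinity> else ennreal (enn2real a powr r))"

(* The distribution function and the Lorentz (quasi-)norms take a nonnegative extended-valued
   function; for a real function f they are applied to its absolute value. *)
definition distribution_fun :: "(real^'n \<Rightarrow> real) \<Rightarrow> (real^'n \<Rightarrow> ennreal) \<Rightarrow> real \<Rightarrow> ennreal" where
  "distribution_fun w f y = emeasure (weight_measure w) {x. f x > ennreal y}"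

definition strong_Lorentz :: "real \<Rightarrow> (real^'n \<Rightarrow> real) \<Rightarrow> (real^'n \<Rightarrow> ennreal) \<Rightarrow> ennreal" where
  "strong_Lorentz q w f =
     ennreal q * (\<integral>\<^sup>+y\<in>{0<..}. ennreal_powr (distribution_fun w f y) (1 / q) \<partial>lborel)"

definition weak_Lorentz :: "ennreal \<Rightarrow> (real^'n \<Rightarrow> real) \<Rightarrow> (real^'n \<Rightarrow> ennreal) \<Rightarrow> ennreal" where
  "weak_Lorentz q w f =
     (if q = \<infinity> then esssup (weight_measure w) f
      else (SUP y\<in>{0<..}. ennreal y * ennreal_powr (distribution_fun w f y) (1 / enn2real q)))"

definition conj_exponent :: "real \<Rightarrow> ennreal" where
  "conj_exponent p = (if p = 1 then \<infinity> else ennreal (p / (p - 1)))"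

lemma conj_exponent_eq:
  assumes "1 \<le> p"
  shows "1 / ennreal p + 1 / conj_exponent p = 1"
proof (cases "p = 1")
  case True
  then show ?thesis by (simp add: conj_exponent_def)
next
  case False
  with assms have p: "p > 1" by simp
  have "1 / ennreal p + 1 / conj_exponent p = ennreal (1 / p) + ennreal (1 / (p / (p - 1)))"
    using p by (simp add: conj_exponent_def divide_ennreal flip: ennreal_1)
  also have "\<dots> = ennreal (1 / p + (p - 1) / p)"
    using p by (subst ennreal_plus) auto
  also have "1 / p + (p - 1) / p = 1"
    using p by (simp add: field_simps)
  finally show ?thesis by simp
qed

definition restricted_A_const ::
  "nat \<Rightarrow> (nat \<Rightarrow> real) \<Rightarrow> real \<Rightarrow> (nat \<Rightarrow> real^'n \<Rightarrow> real) \<Rightarrow> (real^'n \<Rightarrow> real) \<Rightarrow> ennreal" where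
  "restricted_A_const m P p w \<nu> =
     (SUP Q\<in>cubes. ennreal_powr (emeasure (weight_measure \<nu>) Q) (1 / p) *
        (\<Prod>i\<in>{1..m}.
           weak_Lorentz (conj_exponent (P i)) (w i) (\<lambda>x. ennreal (indicator Q x * inverse (w i x)))
           / emeasure lebesgue Q))"

end

theory Submission
  imports Defs
begin

text \<open>The condition on the weights says, up to constants, that the weak-type inequality holds for the
simplest functions. Everything rests on two facts about one weight.

The first is the duality of Lorentz spaces: on a set \<open>T\<close>, the integral of \<open>f = (f w\<inverse>) w\<close> against
Lebesgue measure is at most the product of the norm of \<open>f\<close> in \<open>L\<^bsup>p,1\<^esup>(w)\<close> and the norm of
\<open>\<chi>\<^sub>T w\<inverse>\<close> in \<open>L\<^bsup>p',\<infinity>\<^esup>(w)\<close> (\<open>Holder_Lorentz\<close>). Superlevel sets of \<open>w\<inverse>\<close> show that this bound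
cannot be improved by more than a constant factor. The second is that, for \<open>p \<ge> 1\<close>, the \<open>p\<close>-th
powers of the \<open>L\<^bsup>p,1\<^esup>\<close> norms of the restrictions of \<open>f\<close> to disjoint sets sum to at most the \<open>p\<close>-th
power of the norm of \<open>f\<close> (\<open>Lorentz_on_disjoint_sum\<close>).

Sufficiency is a covering argument that works for arbitrary weights, because only the Lebesgue
measure of a cube is compared with that of its dilation. The set where the maximal function exceeds
\<open>y\<close> is a union of cubes \<open>Q\<close> on which the product of averages exceeds \<open>y\<close>. Among finitely many of
them, choose disjoint ones whose threefold dilations \<open>T\<close> cover the rest. Duality, with \<open>f\<^sub>i\<close> restricted
to \<open>Q\<close> but the reciprocal weight restricted to \<open>T\<close>, together with the condition on the cube \<open>T\<close>, bounds
\<open>y \<nu>(T) powr (1 / p)\<close> by a multiple of the product of the norms of the \<open>f\<^sub>i\<close> over \<open>Q\<close>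
(\<open>multi_average_le_Lorentz\<close>). Summing \<open>p\<close>-th powers over the disjoint cubes and separating the \<open>m\<close>
functions by Hoelder's inequality, where \<open>1 / p = \<Sum>\<^sub>i 1 / p\<^sub>i\<close> is used, gives a bound for finite
unions (\<open>weak_type_finite_cubes\<close>), and Lindelof's theorem passes to the whole set.

For necessity, the inequality is applied to the indicators of the superlevel sets
\<open>{x \<in> Q. w\<^sub>i(x)\<inverse> > y\<^sub>i}\<close> (\<open>weak_type_imp_testing\<close>); the supremum over all \<open>y\<^sub>i\<close> is the
condition.\<close>

section \<open>Finite sums and extended powers\<close>

text \<open>Jensen's inequality for \<^term>\<open>exp\<close> at the points \<open>ln (t i)\<close>. Since \<open>0 powr \<theta> = 0\<close> for every
exponent, including \<open>0\<close>, a vanishing \<open>t i\<close> makes the left-hand side zero.\<close>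

lemma weighted_am_gm:
  fixes t \<theta> :: "'i \<Rightarrow> real"
  assumes "finite I" and "\<And>i. i \<in> I \<Longrightarrow> 0 \<le> \<theta> i" and "sum \<theta> I = 1"
    and t: "\<And>i. i \<in> I \<Longrightarrow> 0 \<le> t i"
  shows "(\<Prod>i\<in>I. t i powr \<theta> i) \<le> (\<Sum>i\<in>I. \<theta> i * t i)"
proof (cases "\<exists>i\<in>I. t i = 0")
  case True
  then have "(\<Prod>i\<in>I. t i powr \<theta> i) = 0"
    using assms(1) by (auto simp: prod_zero_iff)
  moreover have "0 \<le> (\<Sum>i\<in>I. \<theta> i * t i)"
    using assms by (intro sum_nonneg) auto
  ultimately show ?thesis by simp
next
  case False
  with t have pos: "\<And>i. i \<in> I \<Longrightarrow> 0 < t i" by (force simp: less_le)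
  have "I \<noteq> {}" using assms(3) by auto
  have "(\<Prod>i\<in>I. t i powr \<theta> i) = (\<Prod>i\<in>I. exp (\<theta> i * ln (t i)))"
    using False by (intro prod.cong) (auto simp: powr_def)
  also have "\<dots> = exp (\<Sum>i\<in>I. \<theta> i *\<^sub>R ln (t i))"
    using assms(1) by (simp add: exp_sum)
  also have "\<dots> \<le> (\<Sum>i\<in>I. \<theta> i * exp (ln (t i)))"
    using convex_on_sum[OF assms(1) \<open>I \<noteq> {}\<close> exp_convex assms(3)] assms(2) by simp
  also have "\<dots> = (\<Sum>i\<in>I. \<theta> i * t i)"
    using pos by (intro sum.cong) auto
  finally show ?thesis .
qed

text \<open>Normalise each row sum to \<open>1\<close>, bound every product by the weighted arithmetic mean, and sum over
\<open>j\<close>. Zero weights are admitted because the two-factor case with weights \<open>1 - 1 / p\<close> and \<open>1 / p\<close>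
is also applied for \<open>p = 1\<close>.\<close>

lemma Holder_sum:
  fixes a :: "'i \<Rightarrow> 'j \<Rightarrow> real" and \<theta> :: "'i \<Rightarrow> real"
  assumes "finite I" "finite J" and \<theta>: "\<And>i. i \<in> I \<Longrightarrow> 0 \<le> \<theta> i" "sum \<theta> I = 1"
    and a: "\<And>i j. i \<in> I \<Longrightarrow> j \<in> J \<Longrightarrow> 0 \<le> a i j"
  shows "(\<Sum>j\<in>J. \<Prod>i\<in>I. a i j powr \<theta> i) \<le> (\<Prod>i\<in>I. (\<Sum>j\<in>J. a i j) powr \<theta> i)"
proof (cases "\<exists>i\<in>I. (\<Sum>j\<in>J. a i j) = 0")
  case True
  then obtain i where "i \<in> I" "(\<Sum>j\<in>J. a i j) = 0" by auto
  with a assms(2) have "\<And>j. j \<in> J \<Longrightarrow> a i j = 0"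
    by (metis sum_nonneg_eq_0_iff)
  then have "\<And>j. j \<in> J \<Longrightarrow> (\<Prod>i\<in>I. a i j powr \<theta> i) = 0"
    using \<open>i \<in> I\<close> assms(1) by (force simp: prod_zero_iff)
  then show ?thesis by (simp add: prod_nonneg)
next
  case False
  define A where "A i = (\<Sum>j\<in>J. a i j)" for i
  have A: "0 < A i" if "i \<in> I" for i
    using False a that by (metis A_def less_eq_real_def sum_nonneg)
  have "(\<Sum>j\<in>J. \<Prod>i\<in>I. a i j powr \<theta> i) = (\<Prod>i\<in>I. A i powr \<theta> i) * (\<Sum>j\<in>J. \<Prod>i\<in>I. (a i j / A i) powr \<theta> i)"
    unfolding sum_distrib_left prod.distrib[symmetric]
  proof (intro sum.cong prod.cong refl)
    fix j i assume "j \<in> J" "i \<in> I"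
    then show "a i j powr \<theta> i = A i powr \<theta> i * (a i j / A i) powr \<theta> i"
      using A[of i] a[of i j] by (subst powr_mult[symmetric]) auto
  qed
  also have "(\<Sum>j\<in>J. \<Prod>i\<in>I. (a i j / A i) powr \<theta> i) \<le> (\<Sum>j\<in>J. \<Sum>i\<in>I. \<theta> i * (a i j / A i))"
    using A by (intro sum_mono weighted_am_gm assms(1) \<theta>) (auto intro!: divide_nonneg_pos a)
  also have "\<dots> = (\<Sum>i\<in>I. \<theta> i * ((\<Sum>j\<in>J. a i j) / A i))"
    by (subst sum.swap) (simp add: sum_distrib_left sum_divide_distrib)
  also have "\<dots> = (\<Sum>i\<in>I. \<theta> i)"
    unfolding A_def[symmetric] using A by (intro sum.cong) (simp_all add: less_imp_neq[symmetric])
  finally show ?thesis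
    using \<theta>(2) by (simp add: A_def mult_left_mono prod_nonneg)
qed

lemma ennreal_powr_ennreal: "0 \<le> x \<Longrightarrow> ennreal_powr (ennreal x) r = ennreal (x powr r)"
  by (simp add: ennreal_powr_def)

lemma ennreal_powr_0 [simp]: "ennreal_powr 0 r = 0"
  by (simp add: ennreal_powr_def)

lemma ennreal_powr_top [simp]: "ennreal_powr top r = top"
  by (simp add: ennreal_powr_def)

lemma ennreal_powr_mono:
  assumes "a \<le> b" "0 \<le> r"
  shows "ennreal_powr a r \<le> ennreal_powr b r"
proof (cases "b = \<infinity>")
  case False
  then have "a \<noteq> \<infinity>" "enn2real a \<le> enn2real b"
    using assms by (auto simp: top_unique intro!: enn2real_mono simp: less_top)
  then show ?thesis
    using False assms(2) by (auto simp: ennreal_powr_def intro!: ennreal_leI powr_mono2)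
qed (simp add: ennreal_powr_def)

lemma ennreal_powr_powr:
  assumes "r \<noteq> 0"
  shows "ennreal_powr (ennreal_powr a r) (1 / r) = a"
  using assms by (cases a) (auto simp: ennreal_powr_ennreal powr_powr)

lemma measurable_ennreal_powr [measurable (raw)]:
  assumes [measurable]: "f \<in> borel_measurable M"
  shows "(\<lambda>x. ennreal_powr (f x) r) \<in> borel_measurable M"
  unfolding ennreal_powr_def by measurable

section \<open>Weights and the norm of a reciprocal weight\<close>

lemma sigma_finite_lebesgue: "sigma_finite_measure (lebesgue :: 'a::euclidean_space measure)"
proof
  from lborel.sigma_finite_countable obtain A :: "'a set set" where
    A: "countable A" "A \<subseteq> sets lborel" "\<Union>A = UNIV" "\<forall>a\<in>A. emeasure lborel a \<noteq> \<infinity>" by auto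
  then show "\<exists>A::'a set set. countable A \<and> A \<subseteq> sets lebesgue \<and> \<Union>A = space lebesgue \<and>
      (\<forall>a\<in>A. emeasure lebesgue a \<noteq> \<infinity>)"
    by (intro exI[of _ A]) (auto simp: emeasure_completion subset_eq)
qed

text \<open>Fubini's theorem for the region under the graph of \<open>f\<close>. The extra density \<open>g\<close> makes the identity
usable both for Lebesgue measure and, with \<open>f\<close> the reciprocal of a weight, for expressing Lebesgue
measure through the weighted one.\<close>

lemma layer_cake:
  fixes f :: "'a \<Rightarrow> real" and g :: "'a \<Rightarrow> ennreal"
  assumes "sigma_finite_measure M"
    and [measurable]: "f \<in> borel_measurable M" "g \<in> borel_measurable M"
  shows "(\<integral>\<^sup>+x. g x * ennreal (f x) \<partial>M) =
    (\<integral>\<^sup>+t\<in>{0<..}. (\<integral>\<^sup>+x. g x * indicator {x. t < f x} x \<partial>M) \<partial>lborel)"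
proof -
  interpret pair_sigma_finite M lborel
    using assms(1) by (simp add: pair_sigma_finite_def sigma_finite_lborel)
  have "ennreal (f x) = (\<integral>\<^sup>+t. indicator {0<..<f x} t \<partial>lborel)" for x
    by (cases "0 \<le> f x") (auto simp: ennreal_neg)
  then have "(\<integral>\<^sup>+x. g x * ennreal (f x) \<partial>M) =
      (\<integral>\<^sup>+x. \<integral>\<^sup>+t. g x * indicator {0<..<f x} t \<partial>lborel \<partial>M)"
    by (simp add: nn_integral_cmult)
  also have "\<dots> = (\<integral>\<^sup>+x. \<integral>\<^sup>+t. (if 0 < t \<and> t < f x then g x else 0) \<partial>lborel \<partial>M)"
    by (intro nn_integral_cong) (auto simp: indicator_def)
  also have "\<dots> = (\<integral>\<^sup>+t. \<integral>\<^sup>+x. (if 0 < t \<and> t < f x then g x else 0) \<partial>M \<partial>lborel)"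
    by (rule Fubini'[symmetric]) simp
  also have "\<dots> = (\<integral>\<^sup>+t\<in>{0<..}. (\<integral>\<^sup>+x. g x * indicator {x. t < f x} x \<partial>M) \<partial>lborel)"
    by (intro nn_integral_cong) (auto simp: indicator_def if_distrib intro!: nn_integral_cong split: if_splits)
  finally show ?thesis .
qed

lemma sets_weight_measure [measurable_cong, simp]: "sets (weight_measure w) = sets lebesgue"
  by (simp add: weight_measure_def)

lemma space_weight_measure [simp]: "space (weight_measure w) = UNIV"
  by (simp add: weight_measure_def)

lemma weight_measurable: "weight w \<Longrightarrow> w \<in> borel_measurable lebesgue"
  by (simp add: weight_def)

lemma weight_pos: "weight w \<Longrightarrow> 0 < w x"
  by (simp add: weight_def)

lemma emeasure_weight_measure:
  assumes "weight w" "A \<in> sets lebesgue"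
  shows "emeasure (weight_measure w) A = (\<integral>\<^sup>+x. indicator A x * ennreal (w x) \<partial>lebesgue)"
proof -
  have [measurable]: "w \<in> borel_measurable lebesgue" by (rule weight_measurable[OF assms(1)])
  show ?thesis
    unfolding weight_measure_def using assms(2) by (subst emeasure_density) (auto simp: mult.commute)
qed

lemma weight_measure_compact_finite:
  assumes "weight w" "compact K"
  shows "emeasure (weight_measure w) K < \<infinity>"
proof -
  have K: "K \<in> sets lebesgue" using assms(2) by (simp add: compact_imp_closed)
  have "integrable lebesgue (\<lambda>x. indicator K x * w x)"
    using assms by (simp add: weight_def set_integrable_def)
  then have "(\<integral>\<^sup>+x. ennreal (norm (indicator K x * w x)) \<partial>lebesgue) < \<infinity>"
    by (simp add: integrable_iff_bounded)
  also have "(\<integral>\<^sup>+x. ennreal (norm (indicator K x * w x)) \<partial>lebesgue) =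
      (\<integral>\<^sup>+x. indicator K x * ennreal (w x) \<partial>lebesgue)"
    using weight_pos[OF assms(1)]
    by (intro nn_integral_cong) (auto simp: indicator_def less_imp_le)
  finally show ?thesis
    by (simp add: emeasure_weight_measure[OF assms(1) K])
qed

lemma weight_measure_null_imp:
  assumes "weight w" "A \<in> sets lebesgue" "emeasure (weight_measure w) A = 0"
  shows "emeasure lebesgue A = 0"
proof -
  have [measurable]: "w \<in> borel_measurable lebesgue" by (rule weight_measurable[OF assms(1)])
  have "AE x in lebesgue. indicator A x * ennreal (w x) = 0"
    using assms(2,3) unfolding emeasure_weight_measure[OF assms(1,2)]
    by (subst (asm) nn_integral_0_iff_AE) auto
  moreover have "ennreal (w x) \<noteq> 0" for x
    using weight_pos[OF assms(1), of x] by simp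
  ultimately have "AE x in lebesgue. x \<notin> A"
    by (auto elim!: eventually_mono simp: indicator_def split: if_splits)
  then show ?thesis
    using assms(2) by (simp add: AE_iff_measurable[OF _ refl])
qed

abbreviation reciprocal_norm :: "real \<Rightarrow> (real^'n \<Rightarrow> real) \<Rightarrow> (real^'n) set \<Rightarrow> ennreal" where
  "reciprocal_norm p w T \<equiv>
     weak_Lorentz (conj_exponent p) w (\<lambda>x. ennreal (indicator T x * inverse (w x)))"

lemma superlevel_indicator:
  assumes "0 < y"
  shows "{x. ennreal (indicator T x * g x) > ennreal y} = T \<inter> {x. y < g x}"
  using assms by (auto simp: indicator_def ennreal_less_iff split: if_splits)

text \<open>For \<open>p > 1\<close> this is the definition of the weak norm, as \<open>1 / p' = 1 - 1 / p\<close>. For \<open>p = 1\<close> the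
exponent is \<open>0\<close>, and on finite values \<^term>\<open>\<lambda>a. ennreal_powr a 0\<close> is the indicator of \<open>a \<noteq> 0\<close>; the
supremum then runs over the levels whose superlevel set is not null, which gives the essential
supremum. Thus the norm is described by superlevel sets at the endpoint as well.\<close>

lemma reciprocal_norm_eq_SUP:
  fixes w :: "real^'n \<Rightarrow> real"
  assumes w: "weight w" and T: "T \<in> sets lebesgue" and fin: "emeasure (weight_measure w) T < \<infinity>"
    and p: "1 \<le> p"
  shows "reciprocal_norm p w T = (SUP y\<in>{0<..}. ennreal y *
    ennreal_powr (emeasure (weight_measure w) (T \<inter> {x. y < inverse (w x)})) (1 - 1 / p))"
    (is "_ = (SUP y\<in>_. ?g y)")
proof (cases "p = 1")
  case False
  with p have "1 / enn2real (ennreal (p / (p - 1))) = 1 - 1 / p"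
    by (simp add: field_simps)
  with False show ?thesis
    unfolding weak_Lorentz_def conj_exponent_def distribution_fun_def
    by (auto simp: superlevel_indicator)
next
  case True
  define f where "f x = ennreal (indicator T x * inverse (w x))" for x
  have [measurable]: "w \<in> borel_measurable lebesgue" by (rule weight_measurable[OF w])
  have f [measurable]: "f \<in> borel_measurable (weight_measure w)"
    unfolding f_def using T by measurable
  have level: "emeasure (weight_measure w) (T \<inter> {x. y < inverse (w x)}) =
      emeasure (weight_measure w) {x. f x > ennreal y}" if "0 < y" for y
    using that by (simp add: f_def superlevel_indicator)
  have g: "?g y = (if emeasure (weight_measure w) {x. f x > ennreal y} = 0 then 0 else ennreal y)"
    if "0 < y" for y
  proof -
    have "emeasure (weight_measure w) (T \<inter> {x. y < inverse (w x)}) \<le> emeasure (weight_measure w) T"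
      using T by (intro emeasure_mono) auto
    with fin have "emeasure (weight_measure w) (T \<inter> {x. y < inverse (w x)}) < \<infinity>" by simp
    then show ?thesis
      using True unfolding level[OF that]
      by (cases "emeasure (weight_measure w) {x. f x > ennreal y}") (auto simp: ennreal_powr_ennreal)
  qed
  have "esssup (weight_measure w) f = (SUP y\<in>{0<..}. ?g y)"
  proof (rule antisym)
    show "esssup (weight_measure w) f \<le> (SUP y\<in>{0<..}. ?g y)"
    proof (rule ccontr)
      assume "\<not> ?thesis"
      then obtain z where z: "(SUP y\<in>{0<..}. ?g y) < z" "z < esssup (weight_measure w) f"
        by (meson dense not_le)
      then obtain y where y: "z = ennreal y" "0 \<le> y"
        by (cases z) (auto simp: top_unique)
      have "0 < z" using z(1) by (rule le_less_trans[OF zero_le])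
      with y have "0 < y" by simp
      have "0 < emeasure (weight_measure w) {x. f x > z}"
        using esssup_pos_measure[OF f z(2)] by simp
      then have "?g y = z" using g[OF \<open>0 < y\<close>] y by simp
      moreover have "?g y \<le> (SUP y\<in>{0<..}. ?g y)"
        using \<open>0 < y\<close> by (intro SUP_upper) auto
      ultimately show False using z(1) by simp
    qed
    show "(SUP y\<in>{0<..}. ?g y) \<le> esssup (weight_measure w) f"
    proof (rule SUP_least)
      fix y :: real assume "y \<in> {0<..}"
      then have "0 < y" by simp
      have "ennreal y \<le> esssup (weight_measure w) f"
        if "emeasure (weight_measure w) {x. f x > ennreal y} \<noteq> 0"
      proof (rule ccontr)
        have S: "{x \<in> space (weight_measure w). f x > esssup (weight_measure w) f}
            \<in> sets (weight_measure w)"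
          by measurable
        assume "\<not> ennreal y \<le> esssup (weight_measure w) f"
        then have "emeasure (weight_measure w) {x. f x > ennreal y} \<le>
            emeasure (weight_measure w) {x \<in> space (weight_measure w). f x > esssup (weight_measure w) f}"
          by (intro emeasure_mono S) auto
        with that show False by (simp add: esssup_zero_measure del: space_weight_measure)
      qed
      then show "?g y \<le> esssup (weight_measure w) f"
        using g[OF \<open>0 < y\<close>] by auto
    qed
  qed
  then show ?thesis
    using True by (simp add: weak_Lorentz_def conj_exponent_def f_def[abs_def])
qed

lemma reciprocal_norm_superlevel:
  fixes w :: "real^'n \<Rightarrow> real"
  assumes "weight w" "T \<in> sets lebesgue" "emeasure (weight_measure w) T < \<infinity>" "1 \<le> p" "0 < y"
  shows "ennreal y * ennreal_powr (emeasure (weight_measure w) (T \<inter> {x. y < inverse (w x)})) (1 - 1 / p)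
    \<le> reciprocal_norm p w T"
  unfolding reciprocal_norm_eq_SUP[OF assms(1-4)] using assms(5) by (intro SUP_upper) auto

text \<open>Write \<open>1 = w \<cdot> w\<inverse>\<close> and cut \<open>w\<inverse>\<close> into its horizontal layers.\<close>

lemma lebesgue_eq_layers:
  assumes w: "weight w" and E: "E \<in> sets lebesgue"
  shows "emeasure lebesgue E =
    (\<integral>\<^sup>+y\<in>{0<..}. emeasure (weight_measure w) (E \<inter> {x. y < inverse (w x)}) \<partial>lborel)"
proof -
  have [measurable]: "w \<in> borel_measurable lebesgue" by (rule weight_measurable[OF w])
  have "emeasure lebesgue E = (\<integral>\<^sup>+x. indicator E x \<partial>lebesgue)" using E by simp
  also have "\<dots> = (\<integral>\<^sup>+x. (indicator E x * ennreal (w x)) * ennreal (inverse (w x)) \<partial>lebesgue)"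
  proof (intro nn_integral_cong)
    fix x
    show "indicator E x = indicator E x * ennreal (w x) * ennreal (inverse (w x))"
      using weight_pos[OF w, of x]
      by (simp add: mult.assoc ennreal_mult[symmetric])
  qed
  also have "\<dots> = (\<integral>\<^sup>+y\<in>{0<..}. (\<integral>\<^sup>+x. indicator E x * ennreal (w x) *
      indicator {x. y < inverse (w x)} x \<partial>lebesgue) \<partial>lborel)"
    using E by (intro layer_cake sigma_finite_lebesgue) auto
  also have "\<dots> = (\<integral>\<^sup>+y\<in>{0<..}. emeasure (weight_measure w) (E \<inter> {x. y < inverse (w x)}) \<partial>lborel)"
  proof (intro nn_integral_cong arg_cong2[where f="(*)"] refl)
    fix y
    have "E \<inter> {x. y < inverse (w x)} \<in> sets lebesgue" using E by measurable
    then show "(\<integral>\<^sup>+x. indicator E x * ennreal (w x) * indicator {x. y < inverse (w x)} x \<partial>lebesgue) =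
      emeasure (weight_measure w) (E \<inter> {x. y < inverse (w x)})"
      by (simp add: emeasure_weight_measure[OF w] indicator_inter_arith mult_ac)
  qed
  finally show ?thesis .
qed

lemma nn_integral_powr_tail:
  fixes N s y0 :: real
  assumes "0 \<le> N" "1 < s" "0 < y0"
  shows "(\<integral>\<^sup>+y. ennreal ((N / y) powr s) * indicator {y0..} y \<partial>lborel) =
    ennreal (N powr s * y0 powr (1 - s) / (s - 1))"
proof -
  have "(\<integral>\<^sup>+y. ennreal (N powr s * y powr (- s)) * indicator {y0..} y \<partial>lborel) =
      ennreal (0 - N powr s / (1 - s) * y0 powr (1 - s))"
  proof (rule nn_integral_FTC_atLeast)
    fix x assume "y0 \<le> x"
    with assms have "0 < x" by simp
    have "((\<lambda>y. y powr (1 - s)) has_real_derivative (1 - s) * x powr (1 - s - 1)) (at x)"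
      using \<open>0 < x\<close> by (rule has_real_derivative_powr)
    from DERIV_cmult[OF this, of "N powr s / (1 - s)"]
    show "((\<lambda>y. N powr s / (1 - s) * y powr (1 - s)) has_real_derivative N powr s * x powr (- s)) (at x)"
      using assms(2) by simp
  next
    have "((\<lambda>y::real. y powr (1 - s)) \<longlongrightarrow> 0) at_top"
      using assms(2) by (intro tendsto_neg_powr filterlim_ident) auto
    from tendsto_mult_left[OF this, of "N powr s / (1 - s)"]
    show "((\<lambda>y. N powr s / (1 - s) * y powr (1 - s)) \<longlongrightarrow> 0) at_top" by simp
  qed auto
  also have "(\<integral>\<^sup>+y. ennreal (N powr s * y powr (- s)) * indicator {y0..} y \<partial>lborel) =
      (\<integral>\<^sup>+y. ennreal ((N / y) powr s) * indicator {y0..} y \<partial>lborel)"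
    using assms by (intro nn_integral_cong) (auto simp: indicator_def powr_divide powr_minus_divide)
  also have "0 - N powr s / (1 - s) * y0 powr (1 - s) = N powr s * y0 powr (1 - s) / (s - 1)"
    using assms(2) by (simp add: field_simps)
  finally show ?thesis .
qed

text \<open>Hoelder's inequality for \<open>\<chi>\<^sub>E\<close> and \<open>\<chi>\<^sub>T w\<inverse>\<close> in the duality of the Lorentz spaces \<open>L\<^bsup>p,1\<^esup>(w)\<close> and
\<open>L\<^bsup>p',\<infinity>\<^esup>(w)\<close>. Each layer of \<open>w\<inverse>\<close> over \<open>E\<close> has weighted measure at most \<open>W = w(E)\<close>, and at most
\<open>(N / y) powr p'\<close> by the definition of the weak norm \<open>N\<close>. Integrating the smaller of the two bounds
over the height \<open>y\<close> gives \<open>p N W powr (1 / p)\<close>. For \<open>p = 1\<close> the layers above height \<open>N\<close> are null.\<close>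

lemma lebesgue_le_reciprocal_norm:
  fixes w :: "real^'n \<Rightarrow> real"
  assumes w: "weight w" and T: "T \<in> sets lebesgue" and fin: "emeasure (weight_measure w) T < \<infinity>"
    and p: "1 \<le> p" and E: "E \<in> sets lebesgue" "E \<subseteq> T"
  shows "emeasure lebesgue E \<le>
    ennreal p * reciprocal_norm p w T * ennreal_powr (emeasure (weight_measure w) E) (1 / p)"
proof -
  have E_le_T: "emeasure (weight_measure w) E \<le> emeasure (weight_measure w) T"
    using T E by (intro emeasure_mono) auto
  with fin have E_fin: "emeasure (weight_measure w) E < \<infinity>" by simp
  consider (null) "emeasure (weight_measure w) E = 0"
    | (infinite) "emeasure (weight_measure w) E \<noteq> 0" "reciprocal_norm p w T = \<infinity>"
    | (finite) "emeasure (weight_measure w) E \<noteq> 0" "reciprocal_norm p w T < \<infinity>"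
    by (metis infinity_ennreal_def top.not_eq_extremum)
  then show ?thesis
  proof cases
    case null
    then show ?thesis using weight_measure_null_imp[OF w E(1)] by simp
  next
    case infinite
    with E_fin have "ennreal_powr (emeasure (weight_measure w) E) (1 / p) \<noteq> 0"
      by (cases "emeasure (weight_measure w) E") (auto simp: ennreal_powr_ennreal)
    with infinite(2) p show ?thesis by (simp add: ennreal_mult_eq_top_iff ennreal_top_mult)
  next
    case finite
    have [measurable]: "w \<in> borel_measurable lebesgue" by (rule weight_measurable[OF w])
    from finite(1) E_fin obtain W where W: "emeasure (weight_measure w) E = ennreal W" "0 < W"
      by (cases "emeasure (weight_measure w) E") auto
    from finite(2) obtain N where N: "reciprocal_norm p w T = ennreal N" "0 \<le> N"
      by (cases "reciprocal_norm p w T") auto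
    define h where "h y = emeasure (weight_measure w) (E \<inter> {x. y < inverse (w x)})" for y
    have hW: "h y \<le> ennreal W" for y
      unfolding h_def W(1)[symmetric] using E by (intro emeasure_mono) auto
    have hN: "ennreal y * ennreal_powr (h y) (1 - 1 / p) \<le> ennreal N" if "0 < y" for y
    proof -
      have "h y \<le> emeasure (weight_measure w) (T \<inter> {x. y < inverse (w x)})"
        unfolding h_def using E T by (intro emeasure_mono) auto
      then have "ennreal y * ennreal_powr (h y) (1 - 1 / p) \<le>
          ennreal y * ennreal_powr (emeasure (weight_measure w) (T \<inter> {x. y < inverse (w x)})) (1 - 1 / p)"
        using p by (intro mult_left_mono ennreal_powr_mono) (auto simp: field_simps)
      also have "\<dots> \<le> ennreal N"
        using reciprocal_norm_superlevel[OF w T fin p that] N by simp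
      finally show ?thesis .
    qed
    have h_real: "\<exists>H. h y = ennreal H \<and> 0 \<le> H \<and> H \<le> W" for y
      using hW[of y] W(2) by (cases "h y") (auto simp: top_unique)
    have layers: "emeasure lebesgue E = (\<integral>\<^sup>+y\<in>{0<..}. h y \<partial>lborel)"
      unfolding h_def by (rule lebesgue_eq_layers[OF w E(1)])
    have goal: "?thesis \<longleftrightarrow> emeasure lebesgue E \<le> ennreal (p * N * W powr (1 / p))"
      using p W N by (simp add: ennreal_powr_ennreal ennreal_mult)
    show ?thesis
    proof (cases "p = 1")
      case True
      have "h y * indicator {0<..} y \<le> ennreal W * indicator {0..N} y" for y
      proof -
        obtain H where H: "h y = ennreal H" "0 \<le> H" "H \<le> W" using h_real by blast
        have "H = 0" if "N < y" "0 < y"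
          using hN[OF that(2)] that H True N(2)
          by (cases "H = 0") (auto simp: ennreal_powr_ennreal)
        then show ?thesis using H by (auto simp: indicator_def)
      qed
      then have "emeasure lebesgue E \<le> (\<integral>\<^sup>+y. ennreal W * indicator {0..N} y \<partial>lborel)"
        unfolding layers by (intro nn_integral_mono) auto
      also have "\<dots> = ennreal (W * N)"
        using N W by (simp add: nn_integral_cmult_indicator ennreal_mult)
      finally show ?thesis
        unfolding goal using True W by (simp add: mult.commute)
    next
      case False
      with p have p1: "1 < p" by simp
      define s where "s = p / (p - 1)"
      have s: "1 < s" "1 - 1 / p = 1 / s" "1 / (s - 1) = p - 1" "s \<noteq> 0"
        using p1 by (auto simp: s_def field_simps)
      have tail: "h y \<le> ennreal ((N / y) powr s)" if "0 < y" for y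
      proof -
        obtain H where H: "h y = ennreal H" "0 \<le> H" "H \<le> W" using h_real by blast
        have "y * H powr (1 / s) \<le> N"
          using hN[OF that] H that N s(2) by (simp add: ennreal_powr_ennreal ennreal_mult[symmetric])
        then have "H powr (1 / s) \<le> N / y" using that by (simp add: field_simps)
        then have "(H powr (1 / s)) powr s \<le> (N / y) powr s"
          using s by (intro powr_mono2) auto
        then show ?thesis using H s by (simp add: powr_powr ennreal_leI)
      qed
      show ?thesis
      proof (cases "N = 0")
        case True
        have "h y * indicator {0<..} y = 0" for y
          using tail[of y] True by (auto simp: indicator_def)
        then have "emeasure lebesgue E = 0" unfolding layers by (simp only: nn_integral_const) simp
        then show ?thesis by simp
      next
        case False
        with N have "0 < N" by simp
          \<comment> \<open>the height at which the two bounds on a layer agree\<close>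
        define y0 where "y0 = N * W powr (- (1 / s))"
        have "0 < y0" using \<open>0 < N\<close> W by (simp add: y0_def)
        have "emeasure lebesgue E \<le> (\<integral>\<^sup>+y. ennreal W * indicator {0..y0} y +
            ennreal ((N / y) powr s) * indicator {y0..} y \<partial>lborel)"
          unfolding layers
        proof (intro nn_integral_mono)
          fix y
          show "h y * indicator {0<..} y \<le> ennreal W * indicator {0..y0} y +
              ennreal ((N / y) powr s) * indicator {y0..} y"
            using hW[of y] tail[of y] \<open>0 < y0\<close>
            by (cases "y \<le> y0") (auto simp: indicator_def intro: add_increasing2)
        qed
        also have "\<dots> = (\<integral>\<^sup>+y. ennreal W * indicator {0..y0} y \<partial>lborel) +
            (\<integral>\<^sup>+y. ennreal ((N / y) powr s) * indicator {y0..} y \<partial>lborel)"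
          by (intro nn_integral_add) auto
        also have "\<dots> = ennreal (W * y0) + ennreal (N powr s * y0 powr (1 - s) / (s - 1))"
          using N s W \<open>0 < y0\<close>
          by (subst nn_integral_powr_tail) (auto simp: nn_integral_cmult_indicator ennreal_mult)
        also have "\<dots> = ennreal (W * y0 + N powr s * y0 powr (1 - s) / (s - 1))"
          using N W s \<open>0 < y0\<close> by (intro ennreal_plus[symmetric]) auto
        also have "W * y0 + N powr s * y0 powr (1 - s) / (s - 1) = p * N * W powr (1 / p)"
        proof -
          have 1: "W * y0 = N * W powr (1 / p)"
          proof -
            have "W * W powr (- (1 / s)) = W powr (1 + (- (1 / s)))"
              using W by (subst powr_add) auto
            also have "1 + (- (1 / s)) = 1 / p" using s(2) by simp
            finally show ?thesis by (simp add: y0_def)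
          qed
          have "y0 powr (1 - s) = N powr (1 - s) * W powr (- (1 / s) * (1 - s))"
            using \<open>0 < N\<close> W by (simp add: y0_def powr_mult powr_powr)
          moreover have "- (1 / s) * (1 - s) = 1 / p" using s by (simp add: field_simps)
          moreover have "N powr s * N powr (1 - s) = N"
            using \<open>0 < N\<close> by (simp flip: powr_add)
          ultimately have "N powr s * y0 powr (1 - s) = N * W powr (1 / p)"
            by (simp add: mult.assoc[symmetric])
          then have "N powr s * y0 powr (1 - s) / (s - 1) = N * W powr (1 / p) * (1 / (s - 1))"
            by simp
          with 1 show ?thesis unfolding s(3) by (simp add: algebra_simps)
        qed
        finally show ?thesis unfolding goal .
      qed
    qed
  qed
qed

section \<open>Lorentz norms\<close>

abbreviation Lorentz_on :: "real \<Rightarrow> (real^'n \<Rightarrow> real) \<Rightarrow> (real^'n) set \<Rightarrow> (real^'n \<Rightarrow> real) \<Rightarrow> ennreal" where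
  "Lorentz_on p w Q f \<equiv> strong_Lorentz p w (\<lambda>x. ennreal (indicator Q x * \<bar>f x\<bar>))"

lemma Lorentz_on_eq:
  "Lorentz_on p w Q f = ennreal p * (\<integral>\<^sup>+t\<in>{0<..}.
     ennreal_powr (emeasure (weight_measure w) (Q \<inter> {x. t < \<bar>f x\<bar>})) (1 / p) \<partial>lborel)"
proof -
  have "ennreal_powr (distribution_fun w (\<lambda>x. ennreal (indicator Q x * \<bar>f x\<bar>)) t) (1 / p) * indicator {0<..} t =
      ennreal_powr (emeasure (weight_measure w) (Q \<inter> {x. t < \<bar>f x\<bar>})) (1 / p) * indicator {0<..} t" for t :: real
    by (cases "0 < t") (simp_all add: distribution_fun_def superlevel_indicator)
  then show ?thesis by (simp add: strong_Lorentz_def)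
qed

lemma measurable_weight_superlevel:
  assumes w: "weight w" and [measurable]: "Q \<in> sets lebesgue" "f \<in> borel_measurable lebesgue"
  shows "(\<lambda>t::real. emeasure (weight_measure w) (Q \<inter> {x. t < \<bar>f x\<bar>})) \<in> borel_measurable borel"
proof -
  interpret sigma_finite_measure lebesgue by (rule sigma_finite_lebesgue)
  have [measurable]: "w \<in> borel_measurable lebesgue" by (rule weight_measurable[OF w])
  have "emeasure (weight_measure w) (Q \<inter> {x. t < \<bar>f x\<bar>}) =
      (\<integral>\<^sup>+x. (if x \<in> Q \<and> t < \<bar>f x\<bar> then ennreal (w x) else 0) \<partial>lebesgue)" for t
  proof -
    have "Q \<inter> {x. t < \<bar>f x\<bar>} \<in> sets lebesgue" by measurable
    then show ?thesis
      by (auto simp: emeasure_weight_measure[OF w] indicator_def intro!: nn_integral_cong)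
  qed
  moreover have "(\<lambda>t. \<integral>\<^sup>+x. (if x \<in> Q \<and> t < \<bar>f x\<bar> then ennreal (w x) else 0) \<partial>lebesgue)
      \<in> borel_measurable borel"
    by measurable
  ultimately show ?thesis by simp
qed

lemma Lorentz_on_mono:
  assumes "weight w" "Q' \<in> sets lebesgue" "f \<in> borel_measurable lebesgue" "Q \<subseteq> Q'" "0 < p"
  shows "Lorentz_on p w Q f \<le> Lorentz_on p w Q' f"
proof -
  have "Q' \<inter> {x. t < \<bar>f x\<bar>} \<in> sets lebesgue" for t
    using assms(2,3) by measurable
  then show ?thesis
    using assms(4,5) unfolding Lorentz_on_eq
    by (intro mult_left_mono nn_integral_mono mult_right_mono ennreal_powr_mono emeasure_mono) auto
qed

text \<open>By the layer-cake formula it suffices to treat the superlevel sets of \<open>f\<close>, for which the bound is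
\<open>lebesgue_le_reciprocal_norm\<close>; the factor \<open>p\<close> there is the one in the Lorentz norm, so the constant is
\<open>1\<close>. Enlarging \<open>Q\<close> to \<open>T\<close> in the first factor only is what the covering argument needs.\<close>

lemma Holder_Lorentz:
  fixes w :: "real^'n \<Rightarrow> real"
  assumes w: "weight w" and T: "T \<in> sets lebesgue" and fin: "emeasure (weight_measure w) T < \<infinity>"
    and p: "1 \<le> p" and Q: "Q \<in> sets lebesgue" "Q \<subseteq> T" and f: "f \<in> borel_measurable lebesgue"
  shows "(\<integral>\<^sup>+x\<in>Q. ennreal \<bar>f x\<bar> \<partial>lebesgue) \<le> reciprocal_norm p w T * Lorentz_on p w Q f"
proof -
  note [measurable] = Q(1) f
  have [measurable]: "(\<lambda>t::real. emeasure (weight_measure w) (Q \<inter> {x. t < \<bar>f x\<bar>})) \<in> borel_measurable borel"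
    by (rule measurable_weight_superlevel[OF w Q(1) f])
  have Qf [measurable]: "Q \<inter> {x. t < \<bar>f x\<bar>} \<in> sets lebesgue" for t by measurable
  have "(\<integral>\<^sup>+x\<in>Q. ennreal \<bar>f x\<bar> \<partial>lebesgue) = (\<integral>\<^sup>+x. indicator Q x * ennreal \<bar>f x\<bar> \<partial>lebesgue)"
    by (simp add: mult.commute)
  also have "\<dots> = (\<integral>\<^sup>+t\<in>{0<..}. (\<integral>\<^sup>+x. indicator Q x * indicator {x. t < \<bar>f x\<bar>} x \<partial>lebesgue) \<partial>lborel)"
    by (intro layer_cake sigma_finite_lebesgue) measurable
  also have "\<dots> = (\<integral>\<^sup>+t\<in>{0<..}. emeasure lebesgue (Q \<inter> {x. t < \<bar>f x\<bar>}) \<partial>lborel)"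
    using Qf by (simp flip: indicator_inter_arith)
  also have "\<dots> \<le> (\<integral>\<^sup>+t. (ennreal p * reciprocal_norm p w T) *
      (ennreal_powr (emeasure (weight_measure w) (Q \<inter> {x. t < \<bar>f x\<bar>})) (1 / p) * indicator {0<..} t) \<partial>lborel)"
    unfolding mult.assoc[symmetric] using Q(2)
    by (intro nn_integral_mono mult_right_mono lebesgue_le_reciprocal_norm[OF w T fin p]) auto
  also have "\<dots> = (ennreal p * reciprocal_norm p w T) * (\<integral>\<^sup>+t.
      (ennreal_powr (emeasure (weight_measure w) (Q \<inter> {x. t < \<bar>f x\<bar>})) (1 / p) * indicator {0<..} t) \<partial>lborel)"
    by (intro nn_integral_cmult) measurable
  finally show ?thesis
    unfolding Lorentz_on_eq by (simp add: mult_ac)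
qed

text \<open>Minkowski's inequality, with values in \<open>\<ell>\<^sup>p\<close>, for the functions \<open>u j powr (1 / p)\<close>. It is proved by
duality: the integrals \<open>I j\<close> are tested against \<open>I j powr (p - 1)\<close>, the sum is moved under the
integral, and the finite form of the inequality of Hoelder is used at every point.\<close>

lemma Minkowski_sum:
  fixes u :: "'j \<Rightarrow> 'a \<Rightarrow> ennreal" and v :: "'a \<Rightarrow> ennreal" and I :: "'j \<Rightarrow> real"
  assumes J: "finite J" and p: "1 \<le> p"
    and [measurable]: "\<And>j. j \<in> J \<Longrightarrow> u j \<in> borel_measurable M" "v \<in> borel_measurable M"
    and le: "\<And>x. (\<Sum>j\<in>J. u j x) \<le> v x"
    and I: "\<And>j. j \<in> J \<Longrightarrow> (\<integral>\<^sup>+x. ennreal_powr (u j x) (1 / p) \<partial>M) = ennreal (I j)"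
      "\<And>j. j \<in> J \<Longrightarrow> 0 \<le> I j"
    and S: "(\<integral>\<^sup>+x. ennreal_powr (v x) (1 / p) \<partial>M) = ennreal S" "0 \<le> S"
  shows "(\<Sum>j\<in>J. I j powr p) \<le> S powr p"
proof (cases "(\<Sum>j\<in>J. I j powr p) = 0")
  case False
  define X where "X = (\<Sum>j\<in>J. I j powr p)"
  have X: "0 < X" using False unfolding X_def by (simp add: less_le sum_nonneg)
  have pointwise: "(\<Sum>j\<in>J. ennreal (I j powr (p - 1)) * ennreal_powr (u j x) (1 / p)) \<le>
      ennreal (X powr (1 - 1 / p)) * ennreal_powr (v x) (1 / p)" for x
  proof (cases "v x = \<infinity>")
    case True
    then show ?thesis using X by (simp add: ennreal_mult_top)
  next
    case False
    have fin: "u j x \<noteq> \<infinity>" if "j \<in> J" for j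
    proof -
      have "u j x \<le> (\<Sum>j\<in>J. u j x)" using J that by (intro member_le_sum) auto
      with le[of x] False show ?thesis by (metis infinity_ennreal_def neq_top_trans)
    qed
    define b where "b j = enn2real (u j x)" for j
    define c where "c = enn2real (v x)"
    have b: "u j x = ennreal (b j)" "0 \<le> b j" if "j \<in> J" for j
      using fin[OF that] by (auto simp: b_def less_top)
    have c: "v x = ennreal c" "0 \<le> c" using False by (auto simp: c_def less_top)
    have "ennreal (\<Sum>j\<in>J. b j) \<le> ennreal c"
      using le[of x] b c by (simp add: sum_ennreal[symmetric] del: sum_ennreal)
    with c have bc: "(\<Sum>j\<in>J. b j) \<le> c" by simp
    \<comment> \<open>the two factors are indexed by the booleans\<close>
    have "(\<Sum>j\<in>J. \<Prod>k\<in>UNIV. (if k then I j powr p else b j) powr (if k then 1 - 1 / p else 1 / p))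
        \<le> (\<Prod>k\<in>UNIV. (\<Sum>j\<in>J. if k then I j powr p else b j) powr (if k then 1 - 1 / p else 1 / p))"
      using J p b by (intro Holder_sum) (auto simp: UNIV_bool)
    then have "(\<Sum>j\<in>J. I j powr (p * (1 - 1 / p)) * b j powr (1 / p)) \<le>
        X powr (1 - 1 / p) * (\<Sum>j\<in>J. b j) powr (1 / p)"
      by (simp add: UNIV_bool X_def powr_powr mult.commute)
    also have "p * (1 - 1 / p) = p - 1" using p by (simp add: field_simps)
    also have "(\<Sum>j\<in>J. b j) powr (1 / p) \<le> c powr (1 / p)"
      using bc b p by (intro powr_mono2) (auto intro!: sum_nonneg)
    finally have "(\<Sum>j\<in>J. I j powr (p - 1) * b j powr (1 / p)) \<le> X powr (1 - 1 / p) * c powr (1 / p)"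
      by (simp add: mult_left_mono)
    moreover have "(\<Sum>j\<in>J. ennreal (I j powr (p - 1)) * ennreal_powr (u j x) (1 / p)) =
        ennreal (\<Sum>j\<in>J. I j powr (p - 1) * b j powr (1 / p))"
      using b by (subst sum_ennreal[symmetric])
        (auto simp: ennreal_powr_ennreal ennreal_mult intro!: sum.cong)
    ultimately show ?thesis
      using c by (simp add: ennreal_powr_ennreal ennreal_mult[symmetric] ennreal_leI)
  qed
  have "ennreal X = (\<Sum>j\<in>J. ennreal (I j powr (p - 1)) * ennreal (I j))"
  proof -
    have "I j powr p = I j powr (p - 1) * I j" if "j \<in> J" for j
      using I(2)[OF that] by (cases "I j = 0") (simp_all add: powr_diff)
    then have "ennreal X = (\<Sum>j\<in>J. ennreal (I j powr (p - 1) * I j))"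
      unfolding X_def by (subst sum_ennreal) (auto intro!: mult_nonneg_nonneg I(2))
    then show ?thesis using I(2) by (simp add: ennreal_mult)
  qed
  also have "\<dots> = (\<Sum>j\<in>J. \<integral>\<^sup>+x. ennreal (I j powr (p - 1)) * ennreal_powr (u j x) (1 / p) \<partial>M)"
    by (intro sum.cong refl) (simp add: nn_integral_cmult I)
  also have "\<dots> = (\<integral>\<^sup>+x. (\<Sum>j\<in>J. ennreal (I j powr (p - 1)) * ennreal_powr (u j x) (1 / p)) \<partial>M)"
    by (intro nn_integral_sum[symmetric]) measurable
  also have "\<dots> \<le> (\<integral>\<^sup>+x. ennreal (X powr (1 - 1 / p)) * ennreal_powr (v x) (1 / p) \<partial>M)"
    by (intro nn_integral_mono pointwise)
  also have "\<dots> = ennreal (X powr (1 - 1 / p) * S)"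
    using S by (simp add: nn_integral_cmult ennreal_mult)
  finally have "X \<le> X powr (1 - 1 / p) * S" using S(2) by simp
  moreover have "X = X powr (1 - 1 / p) * X powr (1 / p)" using X by (simp flip: powr_add)
  ultimately have "X powr (1 - 1 / p) * X powr (1 / p) \<le> X powr (1 - 1 / p) * S" by simp
  then have "X powr (1 / p) \<le> S" using X by simp
  then have "(X powr (1 / p)) powr p \<le> S powr p" using p by (intro powr_mono2) auto
  then show ?thesis using X p by (simp add: powr_powr X_def)
qed simp

text \<open>Over disjoint pieces the distribution functions add up to at most that of \<open>f\<close>, so Minkowski's
inequality applies. This is where \<open>p \<ge> 1\<close> and the second index \<open>1\<close> of the Lorentz space enter: the
norms over the pieces are \<open>p\<close>-summable.\<close>

lemma Lorentz_on_disjoint_sum: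
  fixes w :: "real^'n \<Rightarrow> real" and Q :: "'j \<Rightarrow> (real^'n) set"
  assumes w: "weight w" and p: "1 \<le> p" and f: "f \<in> borel_measurable lebesgue"
    and J: "finite J" "disjoint_family_on Q J" and Q: "\<And>j. j \<in> J \<Longrightarrow> Q j \<in> sets lebesgue"
    and fin: "Lorentz_on p w UNIV f < \<infinity>"
  shows "(\<Sum>j\<in>J. enn2real (Lorentz_on p w (Q j) f) powr p) \<le> enn2real (Lorentz_on p w UNIV f) powr p"
proof -
  define u where "u A t = emeasure (weight_measure w) (A \<inter> {x. t < \<bar>f x\<bar>}) * indicator {0<..} t"
    for A and t :: real
  define N where "N A = (\<integral>\<^sup>+t. ennreal_powr (u A t) (1 / p) \<partial>lborel)" for A
  have level: "A \<inter> {x. t < \<bar>f x\<bar>} \<in> sets lebesgue" if "A \<in> sets lebesgue" for A and t :: real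
    using f that by measurable
  have LN: "Lorentz_on p w A f = ennreal p * N A" for A
    unfolding Lorentz_on_eq N_def u_def
    by (intro arg_cong2[where f="(*)"] refl nn_integral_cong) (auto simp: indicator_def)
  have N_fin: "N A < \<infinity>" if "A \<in> sets lebesgue" for A
  proof -
    have "ennreal p * N A \<le> Lorentz_on p w UNIV f"
      unfolding LN[symmetric] using p by (intro Lorentz_on_mono w f) auto
    with fin p show ?thesis
      by (auto simp: ennreal_mult_eq_top_iff less_top[symmetric] top_unique)
  qed
  have "(\<Sum>j\<in>J. enn2real (N (Q j)) powr p) \<le> enn2real (N UNIV) powr p"
  proof (rule Minkowski_sum[OF J(1) p])
    show "u (Q j) \<in> borel_measurable lborel" if "j \<in> J" for j
      unfolding u_def using measurable_weight_superlevel[OF w Q[OF that] f] by measurable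
    show "u UNIV \<in> borel_measurable lborel"
    proof -
      have [measurable]: "(\<lambda>t::real. emeasure (weight_measure w) (UNIV \<inter> {x. t < \<bar>f x\<bar>})) \<in> borel_measurable borel"
        by (intro measurable_weight_superlevel w f) simp
      show ?thesis unfolding u_def by measurable
    qed
    show "(\<Sum>j\<in>J. u (Q j) t) \<le> u UNIV t" for t
    proof -
      have "(\<Sum>j\<in>J. emeasure (weight_measure w) (Q j \<inter> {x. t < \<bar>f x\<bar>})) =
          emeasure (weight_measure w) (\<Union>j\<in>J. Q j \<inter> {x. t < \<bar>f x\<bar>})"
        using J Q level by (intro sum_emeasure) (auto simp: disjoint_family_on_def)
      also have "\<dots> \<le> emeasure (weight_measure w) (UNIV \<inter> {x. t < \<bar>f x\<bar>})"
        using level[of UNIV] by (intro emeasure_mono) auto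
      finally show ?thesis
        by (simp add: u_def sum_distrib_right[symmetric] mult_right_mono)
    qed
    show "(\<integral>\<^sup>+t. ennreal_powr (u (Q j) t) (1 / p) \<partial>lborel) = ennreal (enn2real (N (Q j)))" if "j \<in> J" for j
      using N_fin[OF Q[OF that]] by (simp add: N_def)
    show "(\<integral>\<^sup>+t. ennreal_powr (u UNIV t) (1 / p) \<partial>lborel) = ennreal (enn2real (N UNIV))"
      using N_fin[of UNIV] by (simp add: N_def)
  qed auto
  then have "p powr p * (\<Sum>j\<in>J. enn2real (N (Q j)) powr p) \<le> p powr p * enn2real (N UNIV) powr p"
    by (intro mult_left_mono) auto
  then show ?thesis
    using p unfolding LN by (simp add: enn2real_mult powr_mult sum_distrib_left)
qed

section \<open>Cubes\<close>

text \<open>Cubes are described by centre and half side, since dilation then only changes the second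
parameter.\<close>

definition cube :: "real^'n \<Rightarrow> real \<Rightarrow> (real^'n) set" where
  "cube c r = {x. \<forall>i. \<bar>x $ i - c $ i\<bar> \<le> r}"

lemma cube_eq_cbox: "cube c r = cbox (\<chi> i. c $ i - r) (\<chi> i. c $ i + r)"
  by (auto simp: cube_def mem_box_cart abs_le_iff algebra_simps)

lemma cubes_eq: "cubes = {cube c r | c r. 0 < r}"
proof (intro set_eqI iffI)
  fix Q :: "(real^'n) set"
  assume "Q \<in> cubes"
  then obtain a l where Q: "Q = cbox a (\<chi> i. a $ i + l)" "0 < l" by (auto simp: cubes_def)
  have "Q = cube (\<chi> i. a $ i + l / 2) (l / 2)"
    unfolding Q cube_eq_cbox by (intro arg_cong2[where f=cbox]) (auto simp: vec_eq_iff)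
  with Q(2) show "Q \<in> {cube c r | c r. 0 < r}"
    by (intro CollectI exI[of _ "\<chi> i. a $ i + l / 2"] exI[of _ "l / 2"]) auto
next
  fix Q :: "(real^'n) set"
  assume "Q \<in> {cube c r | c r. 0 < r}"
  then obtain c r where Q: "Q = cube c r" "0 < r" by auto
  have "Q = cbox (\<chi> i. c $ i - r) (\<chi> i. (\<chi> i. c $ i - r) $ i + 2 * r)"
    unfolding Q cube_eq_cbox by (intro arg_cong2[where f=cbox]) (auto simp: vec_eq_iff)
  with Q(2) show "Q \<in> cubes"
    unfolding cubes_def by (intro CollectI exI[of _ "\<chi> i. c $ i - r"] exI[of _ "2 * r"]) auto
qed

lemma compact_cube: "compact (cube c r)"
  by (simp add: cube_eq_cbox compact_cbox)

lemma cube_lebesgue [measurable, simp]: "cube c r \<in> sets lebesgue"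
  by (simp add: cube_eq_cbox)

lemma cube_mono: "r \<le> s \<Longrightarrow> cube c r \<subseteq> cube c s"
  by (auto simp: cube_def intro: order_trans)

lemma emeasure_cube:
  fixes c :: "real^'n"
  assumes "0 < r"
  shows "emeasure lebesgue (cube c r) = ennreal ((2 * r) ^ CARD('n))"
proof -
  have "cube c r \<noteq> {}" using assms by (auto simp: cube_def intro!: exI[of _ c])
  then have "measure lborel (cube c r) = (2 * r) ^ CARD('n)"
    unfolding cube_eq_cbox by (subst content_cbox_cart) auto
  moreover have "emeasure lborel (cube c r) = ennreal (measure lborel (cube c r))"
    unfolding cube_eq_cbox by (intro emeasure_eq_ennreal_measure) (simp add: emeasure_lborel_cbox_eq)
  ultimately show ?thesis by (simp add: cube_eq_cbox)
qed

lemma cube_subset_interior: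
  assumes "r < s"
  shows "cube c r \<subseteq> interior (cube c s)"
proof -
  have "cube c r \<subseteq> box (\<chi> i. c $ i - s) (\<chi> i. c $ i + s)"
  proof
    fix x assume "x \<in> cube c r"
    then have "\<bar>x $ i - c $ i\<bar> \<le> r" for i by (simp add: cube_def)
    then have "c $ i - s < x $ i \<and> x $ i < c $ i + s" for i
      using assms by (smt (verit, best))
    then show "x \<in> box (\<chi> i. c $ i - s) (\<chi> i. c $ i + s)" by (simp add: mem_box_cart)
  qed
  also have "\<dots> \<subseteq> interior (cube c s)"
    unfolding cube_eq_cbox by (intro interior_maximal box_subset_cbox open_box)
  finally show ?thesis .
qed

lemma cube_subset_triple:
  assumes "cube c r \<inter> cube d s \<noteq> {}" "r \<le> s"
  shows "cube c r \<subseteq> cube d (3 * s)"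
proof
  fix x assume x: "x \<in> cube c r"
  from assms(1) obtain z where z: "z \<in> cube c r" "z \<in> cube d s" by auto
  have "\<bar>x $ i - d $ i\<bar> \<le> 3 * s" for i
  proof -
    have "\<bar>x $ i - c $ i\<bar> \<le> r" "\<bar>z $ i - c $ i\<bar> \<le> r" "\<bar>z $ i - d $ i\<bar> \<le> s"
      using x z by (auto simp: cube_def)
    with assms(2) show ?thesis by linarith
  qed
  then show "x \<in> cube d (3 * s)" by (simp add: cube_def)
qed

text \<open>Greedy selection: take a largest cube, discard the cubes that meet it (they lie in its threefold
dilation), and continue with the rest.\<close>

lemma Vitali_finite_cubes:
  fixes K :: "((real^'n) \<times> real) set"
  assumes "finite K"
  shows "\<exists>D\<subseteq>K. disjoint_family_on (\<lambda>(c, r). cube c r) D \<and>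
    (\<Union>(c, r)\<in>K. cube c r) \<subseteq> (\<Union>(c, r)\<in>D. cube c (3 * r))"
  using assms
proof (induction K rule: finite_psubset_induct)
  case (psubset K)
  show ?case
  proof (cases "K = {}")
    case False
    define R where "R = Max (snd ` K)"
    have "R \<in> snd ` K" unfolding R_def using False psubset(1) by (intro Max_in) auto
    then obtain d where d: "(d, R) \<in> K" by auto
    have R: "r \<le> R" if "(c, r) \<in> K" for c r
      unfolding R_def using psubset(1) that by (intro Max_ge) force+
    define K' where "K' = {(c, r) \<in> K. cube c r \<inter> cube d R = {}} - {(d, R)}"
    have "K' \<subset> K" using d by (auto simp: K'_def)
    from psubset.IH[OF this] obtain D where D: "D \<subseteq> K'" "disjoint_family_on (\<lambda>(c, r). cube c r) D"
      "(\<Union>(c, r)\<in>K'. cube c r) \<subseteq> (\<Union>(c, r)\<in>D. cube c (3 * r))" by blast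
    have "insert (d, R) D \<subseteq> K" using D(1) d by (auto simp: K'_def)
    moreover have "disjoint_family_on (\<lambda>(c, r). cube c r) (insert (d, R) D)"
      using D(1,2) unfolding disjoint_family_on_def K'_def by fastforce
    moreover have "cube c r \<subseteq> (\<Union>(c, r)\<in>insert (d, R) D. cube c (3 * r))" if "(c, r) \<in> K" for c r
    proof (cases "(c, r) \<in> K'")
      case True
      then have "cube c r \<subseteq> (\<Union>(c, r)\<in>K'. cube c r)" by blast
      from order_trans[OF this D(3)] show ?thesis by auto
    next
      case False
      have "cube c r \<subseteq> cube d (3 * R)"
      proof (cases "cube c r = {}")
        case nonempty: False
        with False that have "cube c r \<inter> cube d R \<noteq> {}" by (auto simp: K'_def)
        then show ?thesis by (rule cube_subset_triple) (rule R[OF that])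
      qed simp
      then show ?thesis by auto
    qed
    ultimately show ?thesis by (intro exI[of _ "insert (d, R) D"]) auto
  qed (auto simp: disjoint_family_on_def)
qed

text \<open>Continuity from below along an enumeration of the family.\<close>

lemma emeasure_Union_le_of_finite:
  assumes "countable F" and F: "F \<subseteq> sets M"
    and le: "\<And>G. finite G \<Longrightarrow> G \<subseteq> F \<Longrightarrow> emeasure M (\<Union>G) \<le> V"
  shows "emeasure M (\<Union>F) \<le> V"
proof (cases "F = {}")
  case False
  define A where "A n = \<Union>(from_nat_into F ` {..n})" for n :: nat
  have sub: "from_nat_into F ` {..n} \<subseteq> F" for n using from_nat_into[OF False] by auto
  have "range A \<subseteq> sets M" unfolding A_def using sub F by (auto intro!: sets.finite_Union)
  moreover have "incseq A" unfolding A_def incseq_def by (auto intro: order_trans)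
  ultimately have "(SUP n. emeasure M (A n)) = emeasure M (\<Union>n. A n)"
    by (rule SUP_emeasure_incseq)
  also have "(\<Union>n. A n) = \<Union>(range (from_nat_into F))" unfolding A_def by auto
  also have "range (from_nat_into F) = F"
    using False assms(1) by (rule range_from_nat_into)
  finally show ?thesis
    using le sub by (metis (no_types, lifting) A_def SUP_least finite_atMost finite_imageI)
qed simp

section \<open>Superlevel sets of the multilinear maximal function\<close>

definition multi_average :: "nat \<Rightarrow> (nat \<Rightarrow> real^'n \<Rightarrow> real) \<Rightarrow> (real^'n) set \<Rightarrow> ennreal" where
  "multi_average m f Q = (\<Prod>i\<in>{1..m}. (\<integral>\<^sup>+y\<in>Q. ennreal \<bar>f i y\<bar> \<partial>lebesgue) / emeasure lebesgue Q)"

lemma multi_maximal_superlevel: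
  "{x. multi_maximal m f x > ennreal y} = \<Union>{Q \<in> cubes. multi_average m f Q > ennreal y}"
proof (intro set_eqI iffI)
  fix x assume "x \<in> {x. multi_maximal m f x > ennreal y}"
  then obtain Q where "Q \<in> cubes" "ennreal y < multi_average m f Q * indicator Q x"
    unfolding multi_maximal_def multi_average_def by (auto simp: less_SUP_iff)
  then show "x \<in> \<Union>{Q \<in> cubes. multi_average m f Q > ennreal y}"
    by (cases "x \<in> Q") auto
next
  fix x assume "x \<in> \<Union>{Q \<in> cubes. multi_average m f Q > ennreal y}"
  then obtain Q where "Q \<in> cubes" "ennreal y < multi_average m f Q" "x \<in> Q" by auto
  then show "x \<in> {x. multi_maximal m f x > ennreal y}"
    unfolding multi_maximal_def multi_average_def by (auto simp: less_SUP_iff intro!: bexI[of _ Q])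
qed

lemma divide_ennreal_rescale:
  assumes "0 < k" "0 < q"
  shows "a / ennreal q = a / ennreal (k * q) * ennreal k"
proof -
  have "ennreal (inverse (k * q)) * ennreal k = ennreal (inverse q)"
    using assms by (subst ennreal_mult[symmetric]) auto
  then show ?thesis
    using assms by (simp add: divide_ennreal_def inverse_ennreal mult.assoc)
qed

text \<open>The integrals grow with the cube, so the average only loses the ratio of the volumes, once for
each factor.\<close>

lemma multi_average_enlarge:
  fixes c :: "real^'n"
  assumes "0 < r" "r \<le> s"
  shows "multi_average m f (cube c r) * ennreal ((r / s) ^ (CARD('n) * m)) \<le> multi_average m f (cube c s)"
proof -
  have "0 < s" using assms by simp
  have k: "0 < (r / s) ^ CARD('n)" using assms \<open>0 < s\<close> by simp
  have "(\<integral>\<^sup>+y\<in>cube c r. ennreal \<bar>f i y\<bar> \<partial>lebesgue) / emeasure lebesgue (cube c r) * ennreal ((r / s) ^ CARD('n))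
      \<le> (\<integral>\<^sup>+y\<in>cube c s. ennreal \<bar>f i y\<bar> \<partial>lebesgue) / emeasure lebesgue (cube c s)" for i
  proof -
    have "(\<integral>\<^sup>+y\<in>cube c r. ennreal \<bar>f i y\<bar> \<partial>lebesgue) / emeasure lebesgue (cube c r) * ennreal ((r / s) ^ CARD('n))
      = (\<integral>\<^sup>+y\<in>cube c r. ennreal \<bar>f i y\<bar> \<partial>lebesgue) / emeasure lebesgue (cube c s)"
    proof -
      have "(r / s) ^ CARD('n) * (2 * s) ^ CARD('n) = ((r / s) * (2 * s)) ^ CARD('n)"
        by (simp only: power_mult_distrib)
      also have "(r / s) * (2 * s) = 2 * r" using \<open>0 < s\<close> by simp
      finally have "(r / s) ^ CARD('n) * (2 * s) ^ CARD('n) = (2 * r) ^ CARD('n)" .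
      then show ?thesis
        using divide_ennreal_rescale[OF k, of "(2 * s) ^ CARD('n)"] \<open>0 < s\<close> assms(1)
        by (simp only: emeasure_cube zero_less_power mult_pos_pos zero_less_numeral)
    qed
    also have "\<dots> \<le> (\<integral>\<^sup>+y\<in>cube c s. ennreal \<bar>f i y\<bar> \<partial>lebesgue) / emeasure lebesgue (cube c s)"
      using cube_mono[OF assms(2), of c]
      by (intro divide_right_mono_ennreal nn_integral_mono mult_left_mono) (auto simp: indicator_def)
    finally show ?thesis .
  qed
  then have "(\<Prod>i\<in>{1..m}. (\<integral>\<^sup>+y\<in>cube c r. ennreal \<bar>f i y\<bar> \<partial>lebesgue) / emeasure lebesgue (cube c r) *
      ennreal ((r / s) ^ CARD('n))) \<le> multi_average m f (cube c s)"
    unfolding multi_average_def by (intro prod_mono_ennreal)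
  then show ?thesis
    using k by (simp add: multi_average_def prod.distrib power_mult ennreal_power[symmetric] less_imp_le)
qed

lemma multi_average_enlarge_greater:
  fixes c :: "real^'n"
  assumes "0 < r" "a < multi_average m f (cube c r)"
  shows "\<exists>s>r. a < multi_average m f (cube c s)"
proof -
  have "((\<lambda>s. multi_average m f (cube c r) * ennreal ((r / s) ^ (CARD('n) * m))) \<longlongrightarrow>
      multi_average m f (cube c r) * ennreal ((r / r) ^ (CARD('n) * m))) (at_right r)"
    using assms(1) by (intro tendsto_mult_ennreal tendsto_ennrealI tendsto_intros) auto
  then have "((\<lambda>s. multi_average m f (cube c r) * ennreal ((r / s) ^ (CARD('n) * m))) \<longlongrightarrow>
      multi_average m f (cube c r)) (at_right r)"
    using assms(1) by simp
  then have "\<forall>\<^sub>F s in at_right r. a < multi_average m f (cube c r) * ennreal ((r / s) ^ (CARD('n) * m))"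
    using assms(2) by (rule order_tendstoD)
  moreover have "\<forall>\<^sub>F s in at_right r. r < s" by (simp add: eventually_at_right_less)
  ultimately have "\<forall>\<^sub>F s in at_right r. r < s \<and> a < multi_average m f (cube c s)"
    by eventually_elim (use multi_average_enlarge[OF assms(1)] less_le_trans in \<open>meson less_imp_le\<close>)
  then show ?thesis
    using eventually_happens[of _ "at_right r"] by auto
qed

text \<open>A cube whose average exceeds the level can be enlarged slightly without losing this property, so
closed cubes may be replaced by open ones. This gives measurability of the superlevel sets, and it
makes the covering theorem of Lindelof available.\<close>

lemma multi_maximal_superlevel_interior:
  "{x. multi_maximal m f x > ennreal y} = \<Union>{interior (cube c r) | c r. 0 < r \<and> multi_average m f (cube c r) > ennreal y}"
  (is "_ = ?R")
proof (rule antisym)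
  show "{x. multi_maximal m f x > ennreal y} \<subseteq> ?R"
  proof
    fix x assume "x \<in> {x. multi_maximal m f x > ennreal y}"
    then obtain c r where cr: "0 < r" "ennreal y < multi_average m f (cube c r)" "x \<in> cube c r"
      unfolding multi_maximal_superlevel cubes_eq by blast
    from multi_average_enlarge_greater[OF cr(1,2)] obtain s where s: "r < s"
      "ennreal y < multi_average m f (cube c s)" by auto
    with cube_subset_interior[OF s(1), of c] cr have "x \<in> interior (cube c s)" "0 < s" by auto
    with s show "x \<in> ?R" by blast
  qed
  show "?R \<subseteq> {x. multi_maximal m f x > ennreal y}"
    unfolding multi_maximal_superlevel cubes_eq using interior_subset by blast
qed

lemma open_multi_maximal_superlevel: "open {x. multi_maximal m f x > ennreal y}"
  unfolding multi_maximal_superlevel_interior by (rule open_Union) auto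

section \<open>Sufficiency of the testing condition\<close>

text \<open>The duality inequality bounds each factor on \<open>Q\<close> by the reciprocal norm on the dilated cube \<open>T\<close>;
replacing \<open>|Q|\<close> by \<open>|T|\<close> costs \<open>3\<^sup>n\<close> for each of the \<open>m\<close> factors, and the quantities left over on \<open>T\<close>
are those controlled by the testing constant.\<close>

lemma multi_average_le_Lorentz:
  fixes w :: "nat \<Rightarrow> real^'n \<Rightarrow> real" and c :: "real^'n"
  assumes P: "\<And>i. i \<in> {1..m} \<Longrightarrow> 1 \<le> P i" and w: "\<And>i. i \<in> {1..m} \<Longrightarrow> weight (w i)"
    and f: "\<And>i. i \<in> {1..m} \<Longrightarrow> f i \<in> borel_measurable lebesgue" and r: "0 < r"
  shows "ennreal_powr (emeasure (weight_measure \<nu>) (cube c (3 * r))) (1 / p) * multi_average m f (cube c r)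
    \<le> ennreal (3 ^ (CARD('n) * m)) * restricted_A_const m P p w \<nu> *
      (\<Prod>i\<in>{1..m}. Lorentz_on (P i) (w i) (cube c r) (f i))"
proof -
  let ?T = "cube c (3 * r)" and ?Q = "cube c r"
  let ?N = "\<lambda>i. reciprocal_norm (P i) (w i) ?T"
  let ?L = "\<lambda>i. Lorentz_on (P i) (w i) ?Q (f i)"
  have average: "(\<integral>\<^sup>+y\<in>?Q. ennreal \<bar>f i y\<bar> \<partial>lebesgue) / emeasure lebesgue ?Q
      \<le> ?N i / emeasure lebesgue ?T * (ennreal (3 ^ CARD('n)) * ?L i)" if "i \<in> {1..m}" for i
  proof -
    have "(\<integral>\<^sup>+y\<in>?Q. ennreal \<bar>f i y\<bar> \<partial>lebesgue) \<le> ?N i * ?L i"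
      using r by (intro Holder_Lorentz w f P that cube_mono weight_measure_compact_finite compact_cube) auto
    then have "(\<integral>\<^sup>+y\<in>?Q. ennreal \<bar>f i y\<bar> \<partial>lebesgue) / emeasure lebesgue ?Q \<le>
        ?N i * ?L i / emeasure lebesgue ?Q"
      by (rule divide_right_mono_ennreal)
    also have "\<dots> = ?N i * ?L i / emeasure lebesgue ?T * ennreal (3 ^ CARD('n))"
    proof -
      have T: "emeasure lebesgue ?T = ennreal ((3 * (2 * r)) ^ CARD('n))"
        using r by (subst emeasure_cube) auto
      have Q: "emeasure lebesgue ?Q = ennreal ((2 * r) ^ CARD('n))"
        using r by (rule emeasure_cube)
      show ?thesis
        unfolding T Q power_mult_distrib[of 3 "2 * r"]
        by (rule divide_ennreal_rescale) (use r in auto)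
    qed
    also have "\<dots> = ?N i / emeasure lebesgue ?T * (ennreal (3 ^ CARD('n)) * ?L i)"
      by (simp add: divide_ennreal_def mult_ac)
    finally show ?thesis .
  qed
  have "multi_average m f ?Q \<le> (\<Prod>i\<in>{1..m}. ?N i / emeasure lebesgue ?T * (ennreal (3 ^ CARD('n)) * ?L i))"
    unfolding multi_average_def by (intro prod_mono_ennreal average)
  also have "\<dots> = (\<Prod>i\<in>{1..m}. ?N i / emeasure lebesgue ?T) *
      (ennreal (3 ^ (CARD('n) * m)) * (\<Prod>i\<in>{1..m}. ?L i))"
    by (simp only: prod.distrib prod_constant card_atLeastAtMost power_mult) (simp add: ennreal_power)
  finally have "ennreal_powr (emeasure (weight_measure \<nu>) ?T) (1 / p) * multi_average m f ?Q \<le>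
      ennreal_powr (emeasure (weight_measure \<nu>) ?T) (1 / p) * \<dots>"
    by (rule mult_left_mono) simp
  also have "\<dots> = (ennreal_powr (emeasure (weight_measure \<nu>) ?T) (1 / p) *
      (\<Prod>i\<in>{1..m}. ?N i / emeasure lebesgue ?T)) * (ennreal (3 ^ (CARD('n) * m)) * (\<Prod>i\<in>{1..m}. ?L i))"
    by (simp only: mult.assoc)
  also have "\<dots> \<le> restricted_A_const m P p w \<nu> * (ennreal (3 ^ (CARD('n) * m)) * (\<Prod>i\<in>{1..m}. ?L i))"
  proof -
    have "?T \<in> cubes"
      unfolding cubes_eq using r by (intro CollectI exI[of _ c] exI[of _ "3 * r"]) simp
    then show ?thesis
      unfolding restricted_A_const_def by (intro mult_right_mono SUP_upper) auto
  qed
  finally show ?thesis by (simp add: mult_ac)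
qed

text \<open>The selected disjoint cubes \<open>Q\<^sub>d\<close> have dilations covering the union, so it suffices to sum the
estimate of \<open>multi_average_le_Lorentz\<close>, raised to the power \<open>p\<close>, over \<open>d\<close>. Hoelder's inequality with
the weights \<open>p / p\<^sub>i\<close>, whose sum is \<open>1\<close> by the relation between the exponents, separates the \<open>m\<close>
functions, and \<open>Lorentz_on_disjoint_sum\<close> puts the pieces of each function together again. All
quantities being finite, the computation is done with real numbers.\<close>

lemma weak_type_finite_cubes:
  fixes w :: "nat \<Rightarrow> real^'n \<Rightarrow> real" and K :: "((real^'n) \<times> real) set"
  assumes P: "\<And>i. i \<in> {1..m} \<Longrightarrow> 1 \<le> P i" and p: "1 / p = (\<Sum>i\<in>{1..m}. 1 / P i)" "0 < p"
    and w: "\<And>i. i \<in> {1..m} \<Longrightarrow> weight (w i)" and \<nu>: "weight \<nu>"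
    and A: "restricted_A_const m P p w \<nu> < \<infinity>"
    and f: "\<And>i. i \<in> {1..m} \<Longrightarrow> f i \<in> borel_measurable lebesgue"
    and fin: "\<And>i. i \<in> {1..m} \<Longrightarrow> Lorentz_on (P i) (w i) UNIV (f i) < \<infinity>"
    and K: "finite K" "\<And>c r. (c, r) \<in> K \<Longrightarrow> 0 < r \<and> ennreal y \<le> multi_average m f (cube c r)"
    and y: "0 < y"
  shows "ennreal y * ennreal_powr (emeasure (weight_measure \<nu>) (\<Union>(c, r)\<in>K. cube c r)) (1 / p)
    \<le> ennreal (3 ^ (CARD('n) * m)) * restricted_A_const m P p w \<nu> *
      (\<Prod>i\<in>{1..m}. Lorentz_on (P i) (w i) UNIV (f i))"
proof -
  define B where "B = 3 ^ (CARD('n) * m) * enn2real (restricted_A_const m P p w \<nu>)"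
  have B: "ennreal (3 ^ (CARD('n) * m)) * restricted_A_const m P p w \<nu> = ennreal B" "0 \<le> B"
    using A by (simp_all add: B_def ennreal_mult less_top)
  define S where "S i = enn2real (Lorentz_on (P i) (w i) UNIV (f i))" for i
  define s where "s i d = enn2real (Lorentz_on (P i) (w i) (case d of (c, r) \<Rightarrow> cube c r) (f i))" for i d
  define n where "n d = enn2real (emeasure (weight_measure \<nu>) (case d of (c, r) \<Rightarrow> cube c (3 * r)))" for d
  have S: "Lorentz_on (P i) (w i) UNIV (f i) = ennreal (S i)" if "i \<in> {1..m}" for i
    using fin[OF that] unfolding S_def by (simp only: ennreal_enn2real infinity_ennreal_def)
  have s: "Lorentz_on (P i) (w i) (cube c r) (f i) = ennreal (s i (c, r))" if "i \<in> {1..m}" for i c r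
  proof -
    have "Lorentz_on (P i) (w i) (cube c r) (f i) \<le> Lorentz_on (P i) (w i) UNIV (f i)"
      using P[OF that] by (intro Lorentz_on_mono w f that) auto
    with fin[OF that] have "Lorentz_on (P i) (w i) (cube c r) (f i) < \<infinity>" by (rule le_less_trans[rotated])
    then show ?thesis by (simp add: s_def)
  qed
  have n: "emeasure (weight_measure \<nu>) (cube c (3 * r)) = ennreal (n (c, r))" for c r
    using weight_measure_compact_finite[OF \<nu> compact_cube, of c "3 * r"] by (simp add: n_def)
  have nonneg: "0 \<le> S i" "0 \<le> s i d" "0 \<le> n d" for i d
    by (auto simp: S_def s_def n_def)
  obtain D where D: "D \<subseteq> K" "disjoint_family_on (\<lambda>(c, r). cube c r) D"
    "(\<Union>(c, r)\<in>K. cube c r) \<subseteq> (\<Union>(c, r)\<in>D. cube c (3 * r))"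
    using Vitali_finite_cubes[OF K(1)] by blast
  have D_fin: "finite D" using D(1) K(1) finite_subset by blast
  have single: "y powr p * n d \<le> B powr p * (\<Prod>i\<in>{1..m}. (s i d powr P i) powr (p / P i))" if "d \<in> D" for d
  proof -
    obtain c r where d: "d = (c, r)" by force
    with that D(1) K(2) have r: "0 < r" and avg: "ennreal y \<le> multi_average m f (cube c r)" by auto
    have "ennreal (n d powr (1 / p)) * ennreal y \<le>
        ennreal_powr (emeasure (weight_measure \<nu>) (cube c (3 * r))) (1 / p) * multi_average m f (cube c r)"
      using avg by (simp add: n d ennreal_powr_ennreal nonneg mult_left_mono)
    also have "\<dots> \<le> ennreal (3 ^ (CARD('n) * m)) * restricted_A_const m P p w \<nu> *
      (\<Prod>i\<in>{1..m}. Lorentz_on (P i) (w i) (cube c r) (f i))"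
      by (intro multi_average_le_Lorentz P w f r)
    also have "\<dots> = ennreal (B * (\<Prod>i\<in>{1..m}. s i d))"
    proof -
      have "(\<Prod>i\<in>{1..m}. Lorentz_on (P i) (w i) (cube c r) (f i)) = (\<Prod>i\<in>{1..m}. ennreal (s i d))"
        unfolding d by (intro prod.cong refl s)
      then show ?thesis
        using B nonneg by (simp add: prod_ennreal ennreal_mult prod_nonneg)
    qed
    finally have "n d powr (1 / p) * y \<le> B * (\<Prod>i\<in>{1..m}. s i d)"
      using B nonneg y by (simp add: ennreal_mult[symmetric] prod_nonneg)
    then have "(n d powr (1 / p) * y) powr p \<le> (B * (\<Prod>i\<in>{1..m}. s i d)) powr p"
      using p y by (intro powr_mono2) auto
    also have "(n d powr (1 / p) * y) powr p = y powr p * n d"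
      using y nonneg p(2) by (simp add: powr_mult powr_powr)
    also have "(B * (\<Prod>i\<in>{1..m}. s i d)) powr p = B powr p * (\<Prod>i\<in>{1..m}. s i d powr p)"
      using B nonneg by (simp add: powr_mult prod_nonneg prod_powr_distrib)
    also have "(\<Prod>i\<in>{1..m}. s i d powr p) = (\<Prod>i\<in>{1..m}. (s i d powr P i) powr (p / P i))"
      using P by (intro prod.cong) (force simp: powr_powr)+
    finally show ?thesis .
  qed
  have theta: "(\<Sum>i\<in>{1..m}. p / P i) = 1"
  proof -
    have "(\<Sum>i\<in>{1..m}. p / P i) = p * (1 / p)" unfolding p(1) by (simp add: sum_distrib_left)
    with p(2) show ?thesis by simp
  qed
  have "y powr p * (\<Sum>d\<in>D. n d) \<le> B powr p * (\<Sum>d\<in>D. \<Prod>i\<in>{1..m}. (s i d powr P i) powr (p / P i))"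
    unfolding sum_distrib_left by (intro sum_mono single)
  also have "(\<Sum>d\<in>D. \<Prod>i\<in>{1..m}. (s i d powr P i) powr (p / P i)) \<le>
      (\<Prod>i\<in>{1..m}. (\<Sum>d\<in>D. s i d powr P i) powr (p / P i))"
    using P p(2) by (intro Holder_sum D_fin theta) (force intro!: divide_nonneg_pos)+
  also have "\<dots> \<le> (\<Prod>i\<in>{1..m}. (S i powr P i) powr (p / P i))"
  proof (intro prod_mono conjI powr_mono2)
    fix i assume i: "i \<in> {1..m}"
    show "0 \<le> p / P i" using P[OF i] p(2) by simp
    show "(\<Sum>d\<in>D. s i d powr P i) \<le> S i powr P i"
      unfolding s_def S_def using D_fin D(2) fin[OF i]
      by (intro Lorentz_on_disjoint_sum w P f i) auto
  qed (auto intro: sum_nonneg)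
  also have "\<dots> = (\<Prod>i\<in>{1..m}. S i) powr p"
  proof -
    have "(S i powr P i) powr (p / P i) = S i powr p" if "i \<in> {1..m}" for i
      using P[OF that] by (simp add: powr_powr)
    then show ?thesis using nonneg by (simp add: prod_powr_distrib)
  qed
  finally have main: "y powr p * (\<Sum>d\<in>D. n d) \<le> B powr p * (\<Prod>i\<in>{1..m}. S i) powr p"
    by (simp add: mult_left_mono)
  have "emeasure (weight_measure \<nu>) (\<Union>(c, r)\<in>K. cube c r) \<le>
      emeasure (weight_measure \<nu>) (\<Union>d\<in>D. case d of (c, r) \<Rightarrow> cube c (3 * r))"
    using D(3) D_fin by (intro emeasure_mono) auto
  also have "\<dots> \<le> (\<Sum>d\<in>D. emeasure (weight_measure \<nu>) (case d of (c, r) \<Rightarrow> cube c (3 * r)))"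
    using D_fin by (intro emeasure_subadditive_finite) auto
  also have "\<dots> = (\<Sum>d\<in>D. ennreal (n d))"
    by (intro sum.cong refl) (auto simp: n)
  also have "\<dots> = ennreal (\<Sum>d\<in>D. n d)"
    using nonneg by (intro sum_ennreal) auto
  finally have "ennreal_powr (emeasure (weight_measure \<nu>) (\<Union>(c, r)\<in>K. cube c r)) (1 / p) \<le>
      ennreal_powr (ennreal (\<Sum>d\<in>D. n d)) (1 / p)"
    using p(2) by (intro ennreal_powr_mono) auto
  then have "ennreal y * ennreal_powr (emeasure (weight_measure \<nu>) (\<Union>(c, r)\<in>K. cube c r)) (1 / p) \<le>
      ennreal y * ennreal ((\<Sum>d\<in>D. n d) powr (1 / p))"
    using nonneg by (intro mult_left_mono) (auto simp: ennreal_powr_ennreal sum_nonneg)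
  also have "\<dots> = ennreal (y * (\<Sum>d\<in>D. n d) powr (1 / p))"
    using y by (simp add: ennreal_mult)
  also have "\<dots> \<le> ennreal (B * (\<Prod>i\<in>{1..m}. S i))"
  proof (rule ennreal_leI)
    have "(y powr p * (\<Sum>d\<in>D. n d)) powr (1 / p) \<le> (B powr p * (\<Prod>i\<in>{1..m}. S i) powr p) powr (1 / p)"
      using p(2) nonneg by (intro powr_mono2 main) (auto intro!: sum_nonneg mult_nonneg_nonneg)
    then show "y * (\<Sum>d\<in>D. n d) powr (1 / p) \<le> B * (\<Prod>i\<in>{1..m}. S i)"
      using p(2) y B nonneg by (simp add: powr_mult powr_powr sum_nonneg prod_nonneg)
  qed
  also have "\<dots> = ennreal (3 ^ (CARD('n) * m)) * restricted_A_const m P p w \<nu> *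
      (\<Prod>i\<in>{1..m}. Lorentz_on (P i) (w i) UNIV (f i))"
  proof -
    have "(\<Prod>i\<in>{1..m}. Lorentz_on (P i) (w i) UNIV (f i)) = (\<Prod>i\<in>{1..m}. ennreal (S i))"
      by (intro prod.cong refl S)
    then show ?thesis
      using B nonneg by (simp add: prod_ennreal ennreal_mult prod_nonneg)
  qed
  finally show ?thesis .
qed

text \<open>Isolating the measure turns a weak-type bound into a plain upper bound on a measure, which passes to
increasing limits of sets.\<close>

lemma mult_ennreal_powr_le_iff:
  assumes "0 < y" "0 < p"
  shows "ennreal y * ennreal_powr a (1 / p) \<le> R \<longleftrightarrow> a \<le> ennreal_powr (R / ennreal y) p"
proof -
  have "ennreal y * ennreal_powr a (1 / p) \<le> R \<longleftrightarrow> ennreal_powr a (1 / p) \<le> R / ennreal y"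
  proof -
    have "R / ennreal y < ennreal_powr a (1 / p) \<longleftrightarrow> R < ennreal_powr a (1 / p) * ennreal y"
      using assms(1) by (intro divide_less_ennreal) auto
    then show ?thesis by (simp only: not_less[symmetric] mult.commute)
  qed
  also have "\<dots> \<longleftrightarrow> a \<le> ennreal_powr (R / ennreal y) p"
  proof
    assume "ennreal_powr a (1 / p) \<le> R / ennreal y"
    then have "ennreal_powr (ennreal_powr a (1 / p)) p \<le> ennreal_powr (R / ennreal y) p"
      using assms(2) by (intro ennreal_powr_mono) auto
    then show "a \<le> ennreal_powr (R / ennreal y) p"
      using ennreal_powr_powr[of "1 / p" a] assms(2) by simp
  next
    assume "a \<le> ennreal_powr (R / ennreal y) p"
    then have "ennreal_powr a (1 / p) \<le> ennreal_powr (ennreal_powr (R / ennreal y) p) (1 / p)"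
      using assms(2) by (intro ennreal_powr_mono) auto
    then show "ennreal_powr a (1 / p) \<le> R / ennreal y"
      using ennreal_powr_powr[of p "R / ennreal y"] assms(2) by simp
  qed
  finally show ?thesis .
qed

lemma weak_Lorentz_finite_exponent:
  assumes "0 < p"
  shows "weak_Lorentz (ennreal p) \<nu> g =
    (SUP y\<in>{0<..}. ennreal y * ennreal_powr (emeasure (weight_measure \<nu>) {x. g x > ennreal y}) (1 / p))"
  using assms by (simp add: weak_Lorentz_def distribution_fun_def)

lemma multi_average_eq_0:
  fixes w :: "nat \<Rightarrow> real^'n \<Rightarrow> real" and c :: "real^'n"
  assumes i: "i \<in> {1..m}" and P: "1 \<le> P i" and w: "weight (w i)" and f: "f i \<in> borel_measurable lebesgue"
    and 0: "Lorentz_on (P i) (w i) UNIV (f i) = 0"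
  shows "multi_average m f (cube c r) = 0"
proof -
  have "(\<integral>\<^sup>+y\<in>cube c r. ennreal \<bar>f i y\<bar> \<partial>lebesgue) \<le>
      reciprocal_norm (P i) (w i) (cube c r) * Lorentz_on (P i) (w i) (cube c r) (f i)"
    by (intro Holder_Lorentz w f P weight_measure_compact_finite compact_cube) auto
  also have "Lorentz_on (P i) (w i) (cube c r) (f i) \<le> Lorentz_on (P i) (w i) UNIV (f i)"
    using P by (intro Lorentz_on_mono w f) auto
  finally have "(\<integral>\<^sup>+y\<in>cube c r. ennreal \<bar>f i y\<bar> \<partial>lebesgue) = 0"
    unfolding 0 by (simp add: mult_left_mono)
  then show ?thesis
    unfolding multi_average_def using i by (intro prod_zero) auto
qed

text \<open>The superlevel set is a countable union of open cubes by Lindelof's theorem, so the bound for finite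
unions passes to the limit. Since \<open>0 \<cdot> \<infinity> = 0\<close>, a vanishing norm has to be separated from infinite
ones: a function of norm zero makes all averages vanish, and otherwise an infinite norm makes the
right-hand side infinite. The summand \<open>1\<close> in \<open>C\<close> keeps it positive.\<close>

lemma weak_type_bound:
  fixes w :: "nat \<Rightarrow> real^'n \<Rightarrow> real"
  assumes P: "\<And>i. i \<in> {1..m} \<Longrightarrow> 1 \<le> P i" and p: "1 / p = (\<Sum>i\<in>{1..m}. 1 / P i)" "0 < p"
    and w: "\<And>i. i \<in> {1..m} \<Longrightarrow> weight (w i)" and \<nu>: "weight \<nu>"
    and A: "restricted_A_const m P p w \<nu> < \<infinity>"
    and f: "\<And>i. i \<in> {1..m} \<Longrightarrow> f i \<in> borel_measurable lebesgue"
    and C: "C = 3 ^ (CARD('n) * m) * enn2real (restricted_A_const m P p w \<nu>) + 1"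
  shows "weak_Lorentz (ennreal p) \<nu> (multi_maximal m f) \<le>
    ennreal C * (\<Prod>i\<in>{1..m}. Lorentz_on (P i) (w i) UNIV (f i))"
proof -
  let ?L = "\<lambda>i. Lorentz_on (P i) (w i) UNIV (f i)"
  have C_pos: "0 < C" unfolding C by (simp add: add_nonneg_pos)
  have AC: "ennreal (3 ^ (CARD('n) * m)) * restricted_A_const m P p w \<nu> \<le> ennreal C"
  proof -
    have "ennreal (3 ^ (CARD('n) * m)) * restricted_A_const m P p w \<nu> =
        ennreal (3 ^ (CARD('n) * m) * enn2real (restricted_A_const m P p w \<nu>))"
      using A by (simp add: ennreal_mult)
    also have "\<dots> \<le> ennreal C" unfolding C by (intro ennreal_leI) simp
    finally show ?thesis .
  qed
  have "ennreal y * ennreal_powr (emeasure (weight_measure \<nu>) {x. multi_maximal m f x > ennreal y}) (1 / p)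
      \<le> ennreal C * prod ?L {1..m}" if y: "0 < y" for y
  proof -
    consider (zero) i where "i \<in> {1..m}" "?L i = 0" | (infinite) "\<forall>i\<in>{1..m}. ?L i \<noteq> 0" "\<exists>i\<in>{1..m}. ?L i = \<infinity>"
      | (finite) "\<And>i. i \<in> {1..m} \<Longrightarrow> ?L i < \<infinity>"
    proof -
      have "(\<exists>i\<in>{1..m}. ?L i = 0) \<or> ((\<forall>i\<in>{1..m}. ?L i \<noteq> 0) \<and> (\<exists>i\<in>{1..m}. ?L i = \<infinity>)) \<or>
          (\<forall>i\<in>{1..m}. ?L i < \<infinity>)"
        by (auto simp: less_top)
      with that show ?thesis by blast
    qed
    then show ?thesis
    proof cases
      case zero
      then have "multi_average m f (cube c r) = 0" for c :: "real^'n" and r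
        using P w f by (intro multi_average_eq_0[where w=w]) auto
      then have "{x. multi_maximal m f x > ennreal y} = {}"
        unfolding multi_maximal_superlevel cubes_eq by auto
      then show ?thesis by (simp only:) simp
    next
      case infinite
      then have "prod ?L {1..m} = \<infinity>"
        by (simp add: ennreal_prod_eq_top)
      with C_pos show ?thesis by (simp add: ennreal_mult_top)
    next
      case finite
      define F where "F = {interior (cube c r) | c r. 0 < r \<and> multi_average m f (cube c r) > ennreal y}"
      have "\<And>S. S \<in> F \<Longrightarrow> open S" unfolding F_def by auto
      then obtain F' where F': "F' \<subseteq> F" "countable F'" "\<Union>F' = \<Union>F"
        by (rule Lindelof)
      have "emeasure (weight_measure \<nu>) (\<Union>F') \<le> ennreal_powr (ennreal C * prod ?L {1..m} / ennreal y) p"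
      proof (rule emeasure_Union_le_of_finite[OF F'(2)])
        show "F' \<subseteq> sets (weight_measure \<nu>)" using F'(1) unfolding F_def by auto
      next
        fix G assume G: "finite G" "G \<subseteq> F'"
        have "\<exists>k. S = interior (cube (fst k) (snd k)) \<and> 0 < snd k \<and>
            ennreal y < multi_average m f (cube (fst k) (snd k))" if "S \<in> G" for S
        proof -
          from that G(2) F'(1) have "S \<in> F" by blast
          then obtain c r where "S = interior (cube c r)" "0 < r" "ennreal y < multi_average m f (cube c r)"
            unfolding F_def by blast
          then show ?thesis by (intro exI[of _ "(c, r)"]) simp
        qed
        then have "\<forall>S\<in>G. \<exists>k. S = interior (cube (fst k) (snd k)) \<and> 0 < snd k \<and>
            ennreal y < multi_average m f (cube (fst k) (snd k))" by blast
        from bchoice[OF this] obtain k where k: "\<And>S. S \<in> G \<Longrightarrow> S = interior (cube (fst (k S)) (snd (k S))) \<and>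
            0 < snd (k S) \<and> ennreal y < multi_average m f (cube (fst (k S)) (snd (k S)))"
          by blast
        have "emeasure (weight_measure \<nu>) (\<Union>G) \<le> emeasure (weight_measure \<nu>) (\<Union>(c, r)\<in>k ` G. cube c r)"
        proof (rule emeasure_mono)
          show "\<Union>G \<subseteq> (\<Union>(c, r)\<in>k ` G. cube c r)"
          proof
            fix x assume "x \<in> \<Union>G"
            then obtain S where "S \<in> G" "x \<in> S" by auto
            then have "x \<in> cube (fst (k S)) (snd (k S))" using k interior_subset by blast
            with \<open>S \<in> G\<close> show "x \<in> (\<Union>(c, r)\<in>k ` G. cube c r)"
              by (auto simp: case_prod_beta)
          qed
          show "(\<Union>(c, r)\<in>k ` G. cube c r) \<in> sets (weight_measure \<nu>)"
            using G(1) by (auto simp: case_prod_beta)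
        qed
        also have "\<dots> \<le> ennreal_powr (ennreal C * prod ?L {1..m} / ennreal y) p"
        proof -
          have "ennreal y * ennreal_powr (emeasure (weight_measure \<nu>) (\<Union>(c, r)\<in>k ` G. cube c r)) (1 / p)
              \<le> ennreal (3 ^ (CARD('n) * m)) * restricted_A_const m P p w \<nu> * prod ?L {1..m}"
          proof (rule weak_type_finite_cubes[OF P p w \<nu> A f finite _ _ y])
            show "finite (k ` G)" using G(1) by simp
            show "0 < r \<and> ennreal y \<le> multi_average m f (cube c r)" if "(c, r) \<in> k ` G" for c r
            proof -
              from that obtain S where "S \<in> G" "k S = (c, r)" by auto
              with k[OF this(1)] show ?thesis by (auto simp: less_imp_le)
            qed
          qed
          also have "\<dots> \<le> ennreal C * prod ?L {1..m}" by (intro mult_right_mono AC) simp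
          finally show ?thesis by (simp only: mult_ennreal_powr_le_iff[OF y p(2)])
        qed
        finally show "emeasure (weight_measure \<nu>) (\<Union>G) \<le> ennreal_powr (ennreal C * prod ?L {1..m} / ennreal y) p" .
      qed
      then show ?thesis
        unfolding mult_ennreal_powr_le_iff[OF y p(2)] multi_maximal_superlevel_interior F'(3) F_def .
    qed
  qed
  then show ?thesis
    unfolding weak_Lorentz_finite_exponent[OF p(2)] by (intro SUP_least) auto
qed

section \<open>Necessity of the testing condition\<close>

lemma Lorentz_on_indicator:
  "Lorentz_on p w UNIV (indicator E) = ennreal p * ennreal_powr (emeasure (weight_measure w) E) (1 / p)"
proof -
  have "ennreal_powr (emeasure (weight_measure w) (UNIV \<inter> {x. t < \<bar>indicator E x :: real\<bar>})) (1 / p) * indicator {0<..} t =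
      ennreal_powr (emeasure (weight_measure w) E) (1 / p) * indicator {0<..<1} t" for t :: real
  proof -
    have "UNIV \<inter> {x. t < \<bar>indicator E x :: real\<bar>} = (if t < 1 then E else {})" if "0 < t"
      using that by (auto simp: indicator_def)
    then show ?thesis by (cases "0 < t") auto
  qed
  then have "Lorentz_on p w UNIV (indicator E) = ennreal p *
      (\<integral>\<^sup>+t. ennreal_powr (emeasure (weight_measure w) E) (1 / p) * indicator {0<..<1::real} t \<partial>lborel)"
    unfolding Lorentz_on_eq by simp
  then show ?thesis by (simp add: nn_integral_cmult_indicator)
qed

lemma weight_superlevel_Chebyshev:
  assumes w: "weight w" and E: "E \<in> sets lebesgue" and y: "0 \<le> y" "\<And>x. x \<in> E \<Longrightarrow> y < inverse (w x)"
  shows "ennreal y * emeasure (weight_measure w) E \<le> emeasure lebesgue E"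
proof -
  have [measurable]: "w \<in> borel_measurable lebesgue" by (rule weight_measurable[OF w])
  have "ennreal y * emeasure (weight_measure w) E = (\<integral>\<^sup>+x. ennreal y * (indicator E x * ennreal (w x)) \<partial>lebesgue)"
    using E by (simp add: emeasure_weight_measure[OF w] nn_integral_cmult)
  also have "\<dots> \<le> (\<integral>\<^sup>+x. indicator E x \<partial>lebesgue)"
  proof (intro nn_integral_mono)
    fix x
    have "y * w x \<le> 1" if "x \<in> E"
      using y(2)[OF that] weight_pos[OF w, of x] by (simp add: field_simps)
    then show "ennreal y * (indicator E x * ennreal (w x)) \<le> indicator E x"
      using y(1) weight_pos[OF w, of x]
      by (cases "x \<in> E") (auto simp: ennreal_mult[symmetric] less_imp_le simp flip: ennreal_1)
  qed
  also have "\<dots> = emeasure lebesgue E" using E by simp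
  finally show ?thesis .
qed

text \<open>The suprema are taken one at a time, the remaining factors being absorbed into the constant \<open>c\<close>.\<close>

lemma mult_prod_SUP_le:
  fixes g :: "'i \<Rightarrow> 'b \<Rightarrow> ennreal"
  assumes "finite I" "Y \<noteq> {}"
    and "\<And>y. (\<And>i. i \<in> I \<Longrightarrow> y i \<in> Y) \<Longrightarrow> c * (\<Prod>i\<in>I. g i (y i)) \<le> K"
  shows "c * (\<Prod>i\<in>I. SUP z\<in>Y. g i z) \<le> K"
  using assms(1,3)
proof (induction I arbitrary: c rule: finite_induct)
  case (insert i I)
  have "c * g i z * (\<Prod>i\<in>I. SUP z\<in>Y. g i z) \<le> K" if "z \<in> Y" for z
  proof (rule insert.IH)
    fix y assume y: "\<And>i. i \<in> I \<Longrightarrow> y i \<in> Y"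
    have "(\<Prod>j\<in>I. g j ((y(i := z)) j)) = (\<Prod>j\<in>I. g j (y j))"
      using insert.hyps by (intro prod.cong) auto
    moreover have "(y(i := z)) j \<in> Y" if "j \<in> insert i I" for j
      using y[of j] \<open>z \<in> Y\<close> that by auto
    from insert.prems[OF this] have "c * (\<Prod>j\<in>insert i I. g j ((y(i := z)) j)) \<le> K" .
    ultimately show "c * g i z * (\<Prod>i\<in>I. g i (y i)) \<le> K"
      using insert.hyps by (simp add: mult.assoc)
  qed
  then have "(SUP z\<in>Y. (c * (\<Prod>i\<in>I. SUP z\<in>Y. g i z)) * g i z) \<le> K"
    by (intro SUP_least) (simp add: mult_ac)
  moreover have "(SUP z\<in>Y. (c * X) * g i z) = c * ((SUP z\<in>Y. g i z) * X)" for X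
    unfolding SUP_mult_left_ennreal[symmetric] by (simp only: mult_ac)
  ultimately show ?case
    using insert.hyps by simp
qed auto

text \<open>Test the inequality with \<open>f\<^sub>i = indicator E\<^sub>i\<close>, where \<open>E\<^sub>i\<close> is the part of the cube \<open>Q\<close> on which
\<open>w\<^sub>i\<inverse> > y\<^sub>i\<close>. On \<open>Q\<close> the maximal function is at least \<open>\<alpha> = \<Prod>\<^sub>i y\<^sub>i w\<^sub>i(E\<^sub>i) / |Q|\<close>, while the Lorentz
norm of \<open>f\<^sub>i\<close> is \<open>p\<^sub>i w\<^sub>i(E\<^sub>i) powr (1 / p\<^sub>i)\<close>. The numbers \<open>w\<^sub>i(E\<^sub>i)\<close> are finite. If
all are positive, dividing by \<open>w\<^sub>i(E\<^sub>i) powr (1 / p\<^sub>i)\<close> gives the claim; if one is zero, the left-hand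
side vanishes.\<close>

lemma weak_type_imp_testing:
  fixes w :: "nat \<Rightarrow> real^'n \<Rightarrow> real" and c :: "real^'n"
  assumes P: "\<And>i. i \<in> {1..m} \<Longrightarrow> 1 \<le> P i" and p: "0 < p"
    and w: "\<And>i. i \<in> {1..m} \<Longrightarrow> weight (w i)" and \<nu>: "weight \<nu>" and C: "0 < C"
    and bound: "\<And>f :: nat \<Rightarrow> real^'n \<Rightarrow> real. (\<And>i. i \<in> {1..m} \<Longrightarrow> f i \<in> borel_measurable lebesgue) \<Longrightarrow>
      weak_Lorentz (ennreal p) \<nu> (multi_maximal m f) \<le>
        ennreal C * (\<Prod>i\<in>{1..m}. Lorentz_on (P i) (w i) UNIV (f i))"
    and r: "0 < r" and y: "\<And>i. i \<in> {1..m} \<Longrightarrow> 0 < y i"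
  shows "ennreal_powr (emeasure (weight_measure \<nu>) (cube c r)) (1 / p) *
    (\<Prod>i\<in>{1..m}. ennreal (y i) * ennreal_powr (emeasure (weight_measure (w i))
        (cube c r \<inter> {x. y i < inverse (w i x)})) (1 - 1 / P i) / emeasure lebesgue (cube c r))
    \<le> ennreal (C * (\<Prod>i\<in>{1..m}. P i))"
proof -
  let ?Q = "cube c r"
  define E where "E i = ?Q \<inter> {x. y i < inverse (w i x)}" for i
  have E [measurable]: "E i \<in> sets lebesgue" if "i \<in> {1..m}" for i
  proof -
    have [measurable]: "w i \<in> borel_measurable lebesgue" by (rule weight_measurable[OF w[OF that]])
    show ?thesis unfolding E_def by measurable
  qed
  define W where "W i = enn2real (emeasure (weight_measure (w i)) (E i))" for i
  have W: "emeasure (weight_measure (w i)) (E i) = ennreal (W i)" if "i \<in> {1..m}" for i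
  proof -
    have "emeasure (weight_measure (w i)) (E i) \<le> emeasure (weight_measure (w i)) ?Q"
      unfolding E_def by (intro emeasure_mono) auto
    also have "\<dots> < \<infinity>" by (rule weight_measure_compact_finite[OF w[OF that] compact_cube])
    finally show ?thesis by (simp add: W_def)
  qed
  have W_nonneg: "0 \<le> W i" for i by (simp add: W_def)
  define q where "q = (2 * r) ^ CARD('n)"
  have q: "emeasure lebesgue ?Q = ennreal q" "0 < q"
    unfolding q_def by (rule emeasure_cube[OF r]) (use r in simp)
  have P_nonneg: "0 \<le> P i" if "i \<in> {1..m}" for i using P[OF that] by simp
  have factor_nonneg: "0 \<le> y i * W i powr (1 - 1 / P i) / q" "0 \<le> y i * W i / q"
    "0 \<le> P i * W i powr (1 / P i)" if "i \<in> {1..m}" for i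
    using y[OF that] q(2) W_nonneg[of i] P_nonneg[OF that] by simp_all
  have rhs_nonneg: "0 \<le> C * (\<Prod>i\<in>{1..m}. P i)"
    using C P_nonneg by (intro mult_nonneg_nonneg prod_nonneg) auto
  define N where "N = enn2real (emeasure (weight_measure \<nu>) ?Q)"
  have N: "emeasure (weight_measure \<nu>) ?Q = ennreal N" "0 \<le> N"
    using weight_measure_compact_finite[OF \<nu> compact_cube, of c r] by (auto simp: N_def)
  have goal: "?thesis \<longleftrightarrow> N powr (1 / p) * (\<Prod>i\<in>{1..m}. y i * W i powr (1 - 1 / P i) / q) \<le> C * (\<Prod>i\<in>{1..m}. P i)"
  proof -
    have "(\<Prod>i\<in>{1..m}. ennreal (y i) * ennreal_powr (emeasure (weight_measure (w i))
        (E i)) (1 - 1 / P i) / emeasure lebesgue ?Q) = (\<Prod>i\<in>{1..m}. ennreal (y i * W i powr (1 - 1 / P i) / q))"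
      using y q by (intro prod.cong refl)
        (simp add: W W_nonneg ennreal_powr_ennreal ennreal_mult[symmetric] divide_ennreal less_imp_le)
    also have "\<dots> = ennreal (\<Prod>i\<in>{1..m}. y i * W i powr (1 - 1 / P i) / q)"
      by (intro prod_ennreal factor_nonneg)
    finally have prod_eq: "(\<Prod>i\<in>{1..m}. ennreal (y i) * ennreal_powr (emeasure (weight_measure (w i))
        (E i)) (1 - 1 / P i) / emeasure lebesgue ?Q) = ennreal (\<Prod>i\<in>{1..m}. y i * W i powr (1 - 1 / P i) / q)" .
    have "0 \<le> (\<Prod>i\<in>{1..m}. y i * W i powr (1 - 1 / P i) / q)"
      by (intro prod_nonneg factor_nonneg)
    with rhs_nonneg show ?thesis
      unfolding E_def[symmetric] prod_eq N(1)
      by (simp add: ennreal_powr_ennreal N(2) ennreal_mult[symmetric])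
  qed
  show ?thesis
  proof (cases "\<exists>i\<in>{1..m}. W i = 0")
    case True
    then have "(\<Prod>i\<in>{1..m}. y i * W i powr (1 - 1 / P i) / q) = 0" by (intro prod_zero) auto
    with rhs_nonneg show ?thesis unfolding goal by (simp only: mult_zero_right)
  next
    case False
    then have W_pos: "0 < W i" if "i \<in> {1..m}" for i
      using W_nonneg[of i] that by (auto simp: less_le)
    define f :: "nat \<Rightarrow> real^'n \<Rightarrow> real" where "f i = indicator (E i)" for i
    have f: "f i \<in> borel_measurable lebesgue" if "i \<in> {1..m}" for i
      unfolding f_def using E[OF that] by measurable
    define \<alpha> where "\<alpha> = (\<Prod>i\<in>{1..m}. y i * W i / q)"
    have \<alpha>: "0 < \<alpha>" unfolding \<alpha>_def using y W_pos q by (intro prod_pos) auto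
    have "ennreal \<alpha> = (\<Prod>i\<in>{1..m}. ennreal (y i * W i / q))"
      unfolding \<alpha>_def by (intro prod_ennreal[symmetric] factor_nonneg)
    also have "\<dots> \<le> multi_average m f ?Q"
      unfolding multi_average_def
    proof (rule prod_mono_ennreal)
      fix i assume i: "i \<in> {1..m}"
      have "ennreal (y i * W i) \<le> emeasure lebesgue (E i)"
        using weight_superlevel_Chebyshev[OF w[OF i] E[OF i], of "y i"] y[OF i] W[OF i] W_nonneg
        by (auto simp: E_def ennreal_mult less_imp_le)
      also have "emeasure lebesgue (E i) = (\<integral>\<^sup>+x. indicator (E i) x \<partial>lebesgue)"
        using E[OF i] by simp
      also have "\<dots> = (\<integral>\<^sup>+x\<in>?Q. ennreal \<bar>f i x\<bar> \<partial>lebesgue)"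
        by (intro nn_integral_cong) (auto simp: f_def E_def indicator_def)
      finally have "ennreal (y i * W i) / emeasure lebesgue ?Q \<le>
          (\<integral>\<^sup>+x\<in>?Q. ennreal \<bar>f i x\<bar> \<partial>lebesgue) / emeasure lebesgue ?Q"
        by (rule divide_right_mono_ennreal)
      then show "ennreal (y i * W i / q) \<le> (\<integral>\<^sup>+x\<in>?Q. ennreal \<bar>f i x\<bar> \<partial>lebesgue) / emeasure lebesgue ?Q"
        using q y[OF i] W_nonneg[of i] by (simp add: divide_ennreal less_imp_le)
    qed
    finally have average: "ennreal \<alpha> \<le> multi_average m f ?Q" .
    define R where "R = C * (\<Prod>i\<in>{1..m}. P i * W i powr (1 / P i))"
    have R: "ennreal C * (\<Prod>i\<in>{1..m}. Lorentz_on (P i) (w i) UNIV (f i)) = ennreal R"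
    proof -
      have "(\<Prod>i\<in>{1..m}. Lorentz_on (P i) (w i) UNIV (f i)) = (\<Prod>i\<in>{1..m}. ennreal (P i * W i powr (1 / P i)))"
      proof (intro prod.cong refl)
        fix i assume i: "i \<in> {1..m}"
        have "Lorentz_on (P i) (w i) UNIV (f i) = ennreal (P i) * ennreal (W i powr (1 / P i))"
          unfolding f_def Lorentz_on_indicator W[OF i] by (simp add: ennreal_powr_ennreal W_nonneg)
        then show "Lorentz_on (P i) (w i) UNIV (f i) = ennreal (P i * W i powr (1 / P i))"
          using P_nonneg[OF i] by (simp add: ennreal_mult)
      qed
      also have "\<dots> = ennreal (\<Prod>i\<in>{1..m}. P i * W i powr (1 / P i))"
        by (intro prod_ennreal factor_nonneg)
      finally have "ennreal C * (\<Prod>i\<in>{1..m}. Lorentz_on (P i) (w i) UNIV (f i)) =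
          ennreal C * ennreal (\<Prod>i\<in>{1..m}. P i * W i powr (1 / P i))" by (simp only:)
      also have "\<dots> = ennreal R"
        unfolding R_def using C by (intro ennreal_mult[symmetric] prod_nonneg factor_nonneg) auto
      finally show ?thesis .
    qed
    have R_nonneg: "0 \<le> R"
      unfolding R_def using C by (intro mult_nonneg_nonneg prod_nonneg factor_nonneg) auto
    \<comment> \<open>superlevel sets are strict, so the level has to stay below \<open>\<alpha>\<close>\<close>
    have "z * (\<alpha> * N powr (1 / p)) \<le> R" if z: "0 < z" "z < 1" for z
    proof -
      have "z * \<alpha> < \<alpha>" "0 < z * \<alpha>" using z \<alpha> by auto
      then have "ennreal (z * \<alpha>) < multi_average m f ?Q"
        using average \<alpha> by (intro less_le_trans[OF _ average]) (simp add: ennreal_less_iff)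
      then have "?Q \<subseteq> {x. multi_maximal m f x > ennreal (z * \<alpha>)}"
        unfolding multi_maximal_superlevel cubes_eq using r by blast
      moreover have "{x. multi_maximal m f x > ennreal (z * \<alpha>)} \<in> sets lebesgue"
        using borel_open[OF open_multi_maximal_superlevel] by (intro sets_completionI_sets) simp
      ultimately have "emeasure (weight_measure \<nu>) ?Q \<le>
          emeasure (weight_measure \<nu>) {x. multi_maximal m f x > ennreal (z * \<alpha>)}"
        by (intro emeasure_mono) simp_all
      then have "ennreal (z * \<alpha>) * ennreal_powr (emeasure (weight_measure \<nu>) ?Q) (1 / p) \<le>
          ennreal (z * \<alpha>) * ennreal_powr (emeasure (weight_measure \<nu>) {x. multi_maximal m f x > ennreal (z * \<alpha>)}) (1 / p)"
        using p by (intro mult_left_mono ennreal_powr_mono) auto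
      also have "\<dots> \<le> weak_Lorentz (ennreal p) \<nu> (multi_maximal m f)"
        unfolding weak_Lorentz_finite_exponent[OF p] using \<open>0 < z * \<alpha>\<close> by (intro SUP_upper) auto
      also have "\<dots> \<le> ennreal R" unfolding R[symmetric] by (intro bound f)
      finally show ?thesis
        using \<open>0 < z * \<alpha>\<close> N R_nonneg
        by (simp add: ennreal_powr_ennreal ennreal_mult[symmetric] mult.assoc)
    qed
    then have "\<alpha> * N powr (1 / p) \<le> R" by (rule field_le_mult_one_interval)
    moreover have "\<alpha> = (\<Prod>i\<in>{1..m}. y i * W i powr (1 - 1 / P i) / q) * (\<Prod>i\<in>{1..m}. W i powr (1 / P i))"
      unfolding \<alpha>_def prod.distrib[symmetric]
    proof (intro prod.cong refl)
      fix i assume i: "i \<in> {1..m}"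
      have "W i powr (1 - 1 / P i) * W i powr (1 / P i) = W i"
        using W_pos[OF i] by (simp flip: powr_add)
      then show "y i * W i / q = y i * W i powr (1 - 1 / P i) / q * W i powr (1 / P i)"
        by (simp add: mult.assoc)
    qed
    moreover have "0 < (\<Prod>i\<in>{1..m}. W i powr (1 / P i))" using W_pos by (intro prod_pos) force
    ultimately show ?thesis
      unfolding goal R_def prod.distrib[of P] by (simp add: mult_ac)
  qed
qed

section \<open>The characterisation\<close>

theorem theorem5p1:
  fixes m :: nat and P :: "nat \<Rightarrow> real" and p :: real
    and w :: "nat \<Rightarrow> real^'n \<Rightarrow> real" and \<nu> :: "real^'n \<Rightarrow> real"
  assumes "1 \<le> m"
    and "\<And>i. i \<in> {1..m} \<Longrightarrow> 1 \<le> P i"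
    and "1 / p = (\<Sum>i\<in>{1..m}. 1 / P i)"
    and "\<And>i. i \<in> {1..m} \<Longrightarrow> weight (w i)"
    and "weight \<nu>"
  shows "(\<exists>C>0. \<forall>f :: nat \<Rightarrow> real^'n \<Rightarrow> real.
            (\<forall>i\<in>{1..m}. f i \<in> borel_measurable lebesgue) \<longrightarrow>
            weak_Lorentz (ennreal p) \<nu> (multi_maximal m f)
              \<le> ennreal C * (\<Prod>i\<in>{1..m}. strong_Lorentz (P i) (w i) (\<lambda>x. ennreal \<bar>f i x\<bar>)))
         \<longleftrightarrow> restricted_A_const m P p w \<nu> < \<infinity>"
proof -
  note m = assms(1) and P = assms(2) and p = assms(3) and w = assms(4) and \<nu> = assms(5)
  have Lorentz_UNIV: "strong_Lorentz q u (\<lambda>x. ennreal \<bar>g x\<bar>) = Lorentz_on q u UNIV g"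
    for q and u g :: "real^'n \<Rightarrow> real" by simp
  have "0 < (\<Sum>i\<in>{1..m}. 1 / P i)"
    using m P by (intro sum_pos) (auto simp: zero_less_divide_iff intro: less_le_trans[OF zero_less_one])
  with p have p_pos: "0 < p" by (metis zero_less_divide_1_iff)
  show ?thesis
    unfolding Lorentz_UNIV
  proof
    assume "\<exists>C>0. \<forall>f :: nat \<Rightarrow> real^'n \<Rightarrow> real. (\<forall>i\<in>{1..m}. f i \<in> borel_measurable lebesgue) \<longrightarrow>
        weak_Lorentz (ennreal p) \<nu> (multi_maximal m f)
          \<le> ennreal C * (\<Prod>i\<in>{1..m}. Lorentz_on (P i) (w i) UNIV (f i))"
    then obtain C where C: "0 < C" and bound: "\<And>f :: nat \<Rightarrow> real^'n \<Rightarrow> real.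
        (\<And>i. i \<in> {1..m} \<Longrightarrow> f i \<in> borel_measurable lebesgue) \<Longrightarrow>
        weak_Lorentz (ennreal p) \<nu> (multi_maximal m f)
          \<le> ennreal C * (\<Prod>i\<in>{1..m}. Lorentz_on (P i) (w i) UNIV (f i))"
      by blast
    have "restricted_A_const m P p w \<nu> \<le> ennreal (C * (\<Prod>i\<in>{1..m}. P i))"
      unfolding restricted_A_const_def
    proof (rule SUP_least)
      fix Q :: "(real^'n) set" assume "Q \<in> cubes"
      then obtain c r where Q: "Q = cube c r" and r: "0 < r" unfolding cubes_eq by blast
      let ?g = "\<lambda>i y. ennreal y * ennreal_powr (emeasure (weight_measure (w i))
          (cube c r \<inter> {x. y < inverse (w i x)})) (1 - 1 / P i) / emeasure lebesgue (cube c r)"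
      have "(\<Prod>i\<in>{1..m}. reciprocal_norm (P i) (w i) (cube c r) / emeasure lebesgue (cube c r)) =
          (\<Prod>i\<in>{1..m}. SUP y\<in>{0<..}. ?g i y)"
      proof (intro prod.cong refl)
        fix i assume i: "i \<in> {1..m}"
        show "reciprocal_norm (P i) (w i) (cube c r) / emeasure lebesgue (cube c r) = (SUP y\<in>{0<..}. ?g i y)"
          unfolding divide_ennreal_def SUP_mult_right_ennreal[symmetric]
          by (subst reciprocal_norm_eq_SUP[OF w[OF i] cube_lebesgue
                weight_measure_compact_finite[OF w[OF i] compact_cube] P[OF i]]) (rule refl)
      qed
      moreover have "ennreal_powr (emeasure (weight_measure \<nu>) (cube c r)) (1 / p) *
          (\<Prod>i\<in>{1..m}. SUP y\<in>{0<..}. ?g i y) \<le> ennreal (C * (\<Prod>i\<in>{1..m}. P i))"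
      proof (rule mult_prod_SUP_le)
        fix y :: "nat \<Rightarrow> real" assume "\<And>i. i \<in> {1..m} \<Longrightarrow> y i \<in> {0<..}"
        then have y: "0 < y i" if "i \<in> {1..m}" for i using that by auto
        show "ennreal_powr (emeasure (weight_measure \<nu>) (cube c r)) (1 / p) *
            (\<Prod>i\<in>{1..m}. ?g i (y i)) \<le> ennreal (C * (\<Prod>i\<in>{1..m}. P i))"
          by (rule weak_type_imp_testing[OF P p_pos w \<nu> C bound r y])
      qed auto
      ultimately show "ennreal_powr (emeasure (weight_measure \<nu>) Q) (1 / p) *
          (\<Prod>i\<in>{1..m}. reciprocal_norm (P i) (w i) Q / emeasure lebesgue Q) \<le> ennreal (C * (\<Prod>i\<in>{1..m}. P i))"
        unfolding Q by (simp only:)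
    qed
    also have "\<dots> < \<infinity>" by simp
    finally show "restricted_A_const m P p w \<nu> < \<infinity>" .
  next
    assume A: "restricted_A_const m P p w \<nu> < \<infinity>"
    define C where "C = 3 ^ (CARD('n) * m) * enn2real (restricted_A_const m P p w \<nu>) + 1"
    have "0 < C" unfolding C_def by (simp add: add_nonneg_pos)
    moreover have "weak_Lorentz (ennreal p) \<nu> (multi_maximal m f)
          \<le> ennreal C * (\<Prod>i\<in>{1..m}. Lorentz_on (P i) (w i) UNIV (f i))"
      if "\<forall>i\<in>{1..m}. f i \<in> borel_measurable lebesgue" for f :: "nat \<Rightarrow> real^'n \<Rightarrow> real"
      using that by (intro weak_type_bound[OF P p p_pos w \<nu> A _ C_def]) auto
    ultimately show "\<exists>C>0. \<forall>f :: nat \<Rightarrow> real^'n \<Rightarrow> real. (\<forall>i\<in>{1..m}. f i \<in> borel_measurable lebesgue) \<longrightarrow>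
        weak_Lorentz (ennreal p) \<nu> (multi_maximal m f)
          \<le> ennreal C * (\<Prod>i\<in>{1..m}. Lorentz_on (P i) (w i) UNIV (f i))"
      by blast
  qed
qed

end
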